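(* Let $M$ be a real smooth, of class $C^1$, differentiable manifold and let $L$ be a flat linear transport over $M$, smooth of class $C^1$. For a vector field $V$ on $M$ and a $C^1$ tensor field $S$ on $M$ put $$(\nabla^L_VS)(x):=\lim_{\varepsilon\to 0}\Bigl\{\frac1\varepsilon\bigl(L_{x_\varepsilon\to x}S(x_\varepsilon)-S(x)\bigr)\Bigr\},\qquad x\in M,$$ where, in some local coordinates in a neighborhood of $x$, the point $x_\varepsilon$ has coordinates $x^i_\varepsilon:=x^i+\varepsilon V^i|_x$, with $V|_x=V^i|_x\,\partial/\partial x^i$ and $\varepsilon$ belonging to some neighborhood of $0\in\mathbb{R}$. Then the map $\nabla^L:V\mapsto\nabla^L_V$ is a linear connection on the algebra $T(M)$ of tensor fields on $M$, i.e. $\nabla^L_V$ is a covariant derivation along $V$.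
   Context: $T^{p,q}_x(M)$ is the space of tensors of type $(p,q)$ at $x\in M$. A flat linear transport (of tensors) over $M$ is a map $L:(x,y)\mapsto L_{x\to y}$, $x,y\in M$, where $L_{x\to y}$ maps the tensor algebra at $x$ into the tensor algebra at $y$, such that for all $x,y,z\in M$ and all types: (i) $L_{x\to y}(T^{p,q}_x(M))\subseteq T^{p,q}_y(M)$; (ii) $L_{x\to y}(\lambda A+\mu A')=\lambda L_{x\to y}A+\mu L_{x\to y}A'$ for $\lambda,\mu\in\mathbb{R}$, $A,A'\in T^{p,q}_x(M)$; (iii) $L_{x\to y}(A_1\otimes A_2)=(L_{x\to y}A_1)\otimes(L_{x\to y}A_2)$; (iv) $L_{x\to y}\circ C=C\circ L_{x\to y}$ for every contraction operator $C$; (v) $L_{y\to z}\circ L_{x\to y}=L_{x\to z}$; (vi) $L_{x\to x}=\mathrm{id}$. For a field of bases $\{E_i\}$ of the tangent spaces with dual bases $\{E^i\}$, write $L_{x\to y}(E_j(x))=H^{i}{}_{j}(y,x)E_i(y)$ (summation over repeated indices); $L$ is smooth of class $C^1$ if the bivector $H(y,x)=H^{i}{}_{j}(y,x)E_i(y)\otimes E^j(x)$ and its inverse bivector are of class $C^1$. A linear connection on $T(M)$ is a map $\nabla:V\mapsto\nabla_V$, defined for vector fields $V$ on $M$ (sections of the tangent bundle), such that the covariant derivation $\nabla_V$ along $V$ has the properties: (1) $\nabla_V$ maps $C^1$ tensor fields of type $(p,q)$ to tensor fields of type $(p,q)$; $\nabla_V\circ C=C\circ\nabla_V$ for every contraction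 operator $C$; $\nabla_V(A\otimes B)=(\nabla_VA)\otimes B+A\otimes(\nabla_VB)$; and $\nabla_V(A+A')=\nabla_VA+\nabla_VA'$, for all $C^1$ tensor fields $A,B,A'$ with $A,A'$ of the same type; (2) $\nabla_Vf=V(f)$, $\nabla_{V+W}=\nabla_V+\nabla_W$ and $\nabla_{fV}A=f\,\nabla_VA$ for all $C^1$ functions $f:M\to\mathbb{R}$, vector fields $V,W$ and $C^1$ tensor fields $A$. *)

theory Defs
  imports "HOL-Analysis.Analysis"
begin

section \<open>Manifolds of class C1\<close>

text \<open>The set is meant to be open; the derivative is continuous in the operator norm.\<close>

definition C1_on :: "('a::real_normed_vector \<Rightarrow> 'b::real_normed_vector) \<Rightarrow> 'a set \<Rightarrow> bool" where
  "C1_on f S \<longleftrightarrow>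
     (\<exists>f' :: 'a \<Rightarrow> 'a \<Rightarrow>\<^sub>L 'b.
        (\<forall>u\<in>S. (f has_derivative blinfun_apply (f' u)) (at u)) \<and> continuous_on S f')"

text \<open>A chart is a pair of a coordinate neighbourhood and a coordinate map; the values of the map
  outside the neighbourhood are irrelevant.\<close>

type_synonym ('m, 'n) chart = "'m set \<times> ('m \<Rightarrow> real ^ 'n)"

definition chart_inv :: "('m, 'n) chart \<Rightarrow> real ^ 'n \<Rightarrow> 'm" where
  "chart_inv c = inv_into (fst c) (snd c)"

definition charts_at :: "('m, 'n) chart set \<Rightarrow> 'm \<Rightarrow> ('m, 'n) chart set" where
  "charts_at \<A> x = {c \<in> \<A>. x \<in> fst c}"

text \<open>The atlas is not required to be maximal. For an atlas that is merely of class C1 the notion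
  of a C1 tensor field depends on the atlas (the Jacobians of the coordinate changes are only
  continuous), so the atlas is kept as part of the structure, and below \<open>of class C1\<close> always means
  that the components are C1 in every chart of it. If the atlas is of class C2 or better, this is
  the usual notion. Second countability is not assumed.\<close>

definition C1_manifold :: "'m topology \<Rightarrow> ('m, 'n::finite) chart set \<Rightarrow> bool" where
  "C1_manifold X \<A> \<longleftrightarrow>
     Hausdorff_space X \<and>
     (\<Union>c\<in>\<A>. fst c) = topspace X \<and>
     (\<forall>c\<in>\<A>. openin X (fst c) \<and> open (snd c ` fst c) \<and>
        homeomorphic_map (subtopology X (fst c)) (top_of_set (snd c ` fst c)) (snd c)) \<and>
     (\<forall>c\<in>\<A>. \<forall>d\<in>\<A>. C1_on (snd d \<circ> chart_inv c) (snd c ` (fst c \<inter> fst d)))"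

text \<open>\<open>jacobian c d x i k\<close> is the partial derivative at \<open>x\<close> of the \<open>i\<close>-th coordinate of \<open>d\<close> with
  respect to the \<open>k\<close>-th coordinate of \<open>c\<close>.\<close>

definition jacobian :: "('m, 'n::finite) chart \<Rightarrow> ('m, 'n) chart \<Rightarrow> 'm \<Rightarrow> 'n \<Rightarrow> 'n \<Rightarrow> real" where
  "jacobian c d x i k =
     matrix (frechet_derivative (snd d \<circ> chart_inv c) (at (snd c x))) $ i $ k"


section \<open>Tensors at a point\<close>

text \<open>A tensor at \<open>x\<close> is given by its components in all charts around \<open>x\<close>, subject to the classical
  transformation law. In \<open>T c I J\<close> the list \<open>I\<close> holds the contravariant (upper) and \<open>J\<close> the
  covariant (lower) indices. Components that are not meaningful are set to zero, so that equality
  of tensors is equality of functions. Vectors have type (1,0) and covectors type (0,1). Sums of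
  tensors of different types are represented in the same type.\<close>

type_synonym ('m, 'n) tensor = "('m, 'n) chart \<Rightarrow> 'n list \<Rightarrow> 'n list \<Rightarrow> real"

definition tensors_at ::
  "('m, 'n::finite) chart set \<Rightarrow> 'm \<Rightarrow> nat \<Rightarrow> nat \<Rightarrow> ('m, 'n) tensor set" where
  "tensors_at \<A> x p q =
     {T. (\<forall>c I J. T c I J \<noteq> 0 \<longrightarrow> c \<in> charts_at \<A> x \<and> length I = p \<and> length J = q) \<and>
         (\<forall>c\<in>charts_at \<A> x. \<forall>d\<in>charts_at \<A> x. \<forall>I J. length I = p \<longrightarrow> length J = q \<longrightarrow>
            T d I J =
              (\<Sum>K\<in>{K. length K = p}. \<Sum>L\<in>{L. length L = q}.
                 (\<Prod>r<p. jacobian c d x (I ! r) (K ! r)) *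
                 (\<Prod>s<q. jacobian d c x (L ! s) (J ! s)) * T c K L))}"

definition tzero :: "('m, 'n) tensor" where
  "tzero = (\<lambda>c I J. 0)"

definition tadd :: "('m, 'n) tensor \<Rightarrow> ('m, 'n) tensor \<Rightarrow> ('m, 'n) tensor" where
  "tadd A B = (\<lambda>c I J. A c I J + B c I J)"

definition tscale :: "real \<Rightarrow> ('m, 'n) tensor \<Rightarrow> ('m, 'n) tensor" where
  "tscale a A = (\<lambda>c I J. a * A c I J)"

definition tlincomb :: "('n::finite \<Rightarrow> real) \<Rightarrow> ('n \<Rightarrow> ('m, 'n) tensor) \<Rightarrow> ('m, 'n) tensor" where
  "tlincomb a E = (\<lambda>c I J. \<Sum>i\<in>UNIV. a i * E i c I J)"

text \<open>If \<open>A\<close> has type \<open>(p,q)\<close>, only the summand with \<open>k = p\<close> and \<open>l = q\<close> can be nonzero, which is the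
  usual product of components. Summing over all splittings extends the product to the
  whole tensor algebra.\<close>

definition tprod :: "('m, 'n) tensor \<Rightarrow> ('m, 'n) tensor \<Rightarrow> ('m, 'n) tensor" where
  "tprod A B = (\<lambda>c I J. \<Sum>k\<le>length I. \<Sum>l\<le>length J.
     A c (take k I) (take l J) * B c (drop k I) (drop l J))"

text \<open>Contraction of the upper index in position \<open>r\<close> with the lower index in position \<open>s\<close>
  (counted from 0). It is a contraction operator on type \<open>(p,q)\<close> only for \<open>r < p\<close> and \<open>s < q\<close>.\<close>

definition tcontract :: "nat \<Rightarrow> nat \<Rightarrow> ('m, 'n::finite) tensor \<Rightarrow> ('m, 'n) tensor" where
  "tcontract r s A = (\<lambda>c I J. \<Sum>k\<in>UNIV.
     A c (take r I @ k # drop r I) (take s J @ k # drop s J))"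

definition tscalar :: "('m, 'n) chart set \<Rightarrow> 'm \<Rightarrow> real \<Rightarrow> ('m, 'n) tensor" where
  "tscalar \<A> x a = (\<lambda>c I J. if c \<in> charts_at \<A> x \<and> I = [] \<and> J = [] then a else 0)"

definition tpart :: "nat \<Rightarrow> nat \<Rightarrow> ('m, 'n) tensor \<Rightarrow> ('m, 'n) tensor" where
  "tpart p q T = (\<lambda>c I J. if length I = p \<and> length J = q then T c I J else 0)"

definition tensor_algebra :: "('m, 'n::finite) chart set \<Rightarrow> 'm \<Rightarrow> ('m, 'n) tensor set" where
  "tensor_algebra \<A> x =
     {T. (\<forall>p q. tpart p q T \<in> tensors_at \<A> x p q) \<and> finite {(p, q). tpart p q T \<noteq> tzero}}"


section \<open>Tensor fields\<close>

definition tensor_field ::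
  "'m topology \<Rightarrow> ('m, 'n::finite) chart set \<Rightarrow> nat \<Rightarrow> nat \<Rightarrow> ('m \<Rightarrow> ('m, 'n) tensor) \<Rightarrow> bool" where
  "tensor_field X \<A> p q S \<longleftrightarrow> (\<forall>x\<in>topspace X. S x \<in> tensors_at \<A> x p q)"

definition C1_tensor_field ::
  "'m topology \<Rightarrow> ('m, 'n::finite) chart set \<Rightarrow> nat \<Rightarrow> nat \<Rightarrow> ('m \<Rightarrow> ('m, 'n) tensor) \<Rightarrow> bool" where
  "C1_tensor_field X \<A> p q S \<longleftrightarrow>
     tensor_field X \<A> p q S \<and>
     (\<forall>c\<in>\<A>. \<forall>I J. length I = p \<longrightarrow> length J = q \<longrightarrow>
        C1_on (\<lambda>u. S (chart_inv c u) c I J) (snd c ` fst c))"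

definition C1_function :: "('m, 'n::finite) chart set \<Rightarrow> ('m \<Rightarrow> real) \<Rightarrow> bool" where
  "C1_function \<A> f \<longleftrightarrow> (\<forall>c\<in>\<A>. C1_on (f \<circ> chart_inv c) (snd c ` fst c))"

definition vector_components ::
  "('m, 'n) tensor \<Rightarrow> ('m, 'n::finite) chart \<Rightarrow> real ^ 'n" where
  "vector_components v c = (\<chi> i. v c [i] [])"

text \<open>The derivative of \<open>f\<close> in direction of the vector \<open>V x\<close>, computed in the chart \<open>c\<close>.\<close>

definition vf_deriv ::
  "('m, 'n::finite) chart \<Rightarrow> ('m \<Rightarrow> ('m, 'n) tensor) \<Rightarrow> ('m \<Rightarrow> real) \<Rightarrow> 'm \<Rightarrow> real" where
  "vf_deriv c V f x =
     frechet_derivative (f \<circ> chart_inv c) (at (snd c x)) (vector_components (V x) c)"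


section \<open>Flat linear transports\<close>

text \<open>\<open>L x y\<close> is the transport from \<open>x\<close> to \<open>y\<close>.\<close>

definition flat_linear_transport ::
  "'m topology \<Rightarrow> ('m, 'n::finite) chart set \<Rightarrow>
   ('m \<Rightarrow> 'm \<Rightarrow> ('m, 'n) tensor \<Rightarrow> ('m, 'n) tensor) \<Rightarrow> bool" where
  "flat_linear_transport X \<A> L \<longleftrightarrow>
     (\<forall>x\<in>topspace X. \<forall>y\<in>topspace X.
        L x y ` tensor_algebra \<A> x \<subseteq> tensor_algebra \<A> y) \<and>
     (\<forall>x\<in>topspace X. \<forall>y\<in>topspace X. \<forall>p q.
        L x y ` tensors_at \<A> x p q \<subseteq> tensors_at \<A> y p q) \<and>
     (\<forall>x\<in>topspace X. \<forall>y\<in>topspace X. \<forall>p q a b.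
        \<forall>A\<in>tensors_at \<A> x p q. \<forall>B\<in>tensors_at \<A> x p q.
          L x y (tadd (tscale a A) (tscale b B)) = tadd (tscale a (L x y A)) (tscale b (L x y B))) \<and>
     (\<forall>x\<in>topspace X. \<forall>y\<in>topspace X. \<forall>p q p' q'.
        \<forall>A\<in>tensors_at \<A> x p q. \<forall>B\<in>tensors_at \<A> x p' q'.
          L x y (tprod A B) = tprod (L x y A) (L x y B)) \<and>
     (\<forall>x\<in>topspace X. \<forall>y\<in>topspace X. \<forall>p q r s. r < p \<longrightarrow> s < q \<longrightarrow>
        (\<forall>A\<in>tensors_at \<A> x p q. L x y (tcontract r s A) = tcontract r s (L x y A))) \<and>
     (\<forall>x\<in>topspace X. \<forall>y\<in>topspace X. \<forall>z\<in>topspace X. \<forall>A\<in>tensor_algebra \<A> x.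
        L y z (L x y A) = L x z A) \<and>
     (\<forall>x\<in>topspace X. \<forall>A\<in>tensor_algebra \<A> x. L x x A = A)"

definition frame_field ::
  "'m topology \<Rightarrow> ('m, 'n::finite) chart set \<Rightarrow> ('m \<Rightarrow> 'n \<Rightarrow> ('m, 'n) tensor) \<Rightarrow> bool" where
  "frame_field X \<A> E \<longleftrightarrow>
     (\<forall>x\<in>topspace X.
        (\<forall>i. E x i \<in> tensors_at \<A> x 1 0) \<and>
        (\<forall>v\<in>tensors_at \<A> x 1 0. \<exists>!a. v = tlincomb a (E x)))"

definition dual_frame_field ::
  "'m topology \<Rightarrow> ('m, 'n::finite) chart set \<Rightarrow> ('m \<Rightarrow> 'n \<Rightarrow> ('m, 'n) tensor) \<Rightarrow>
   ('m \<Rightarrow> 'n \<Rightarrow> ('m, 'n) tensor) \<Rightarrow> bool" where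
  "dual_frame_field X \<A> E E' \<longleftrightarrow>
     (\<forall>x\<in>topspace X.
        (\<forall>i. E' x i \<in> tensors_at \<A> x 0 1) \<and>
        (\<forall>i j. tcontract 0 0 (tprod (E x j) (E' x i)) = tscalar \<A> x (if i = j then 1 else 0)))"

text \<open>The bivector is a tensor at two points \<open>y\<close> and \<open>x\<close>; it is of class C1 if its components
  are jointly C1 with respect to all pairs of charts around \<open>y\<close> and around \<open>x\<close>. The frames
  themselves need not be continuous.\<close>

definition C1_bivector ::
  "('m, 'n::finite) chart set \<Rightarrow> ('m \<Rightarrow> 'n \<Rightarrow> ('m, 'n) tensor) \<Rightarrow> ('m \<Rightarrow> 'n \<Rightarrow> ('m, 'n) tensor) \<Rightarrow>
   ('m \<Rightarrow> 'm \<Rightarrow> real ^ 'n ^ 'n) \<Rightarrow> bool" where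
  "C1_bivector \<A> E E' H \<longleftrightarrow>
     (\<forall>c\<in>\<A>. \<forall>d\<in>\<A>. \<forall>k l.
        C1_on (\<lambda>(u, v). \<Sum>i\<in>UNIV. \<Sum>j\<in>UNIV.
                 H (chart_inv c u) (chart_inv d v) $ i $ j *
                 E (chart_inv c u) i c [k] [] * E' (chart_inv d v) j d [] [l])
              ((snd c ` fst c) \<times> (snd d ` fst d)))"

text \<open>The bivector, and hence this condition, does not depend on the choice of the frame field.
  The inverse of \<open>H y x\<close> maps the tangent space at \<open>y\<close> to that at \<open>x\<close>, so the inverse bivector has
  its vector index at \<open>x\<close> and its covector index at \<open>y\<close>.\<close>

definition C1_transport ::
  "'m topology \<Rightarrow> ('m, 'n::finite) chart set \<Rightarrow>
   ('m \<Rightarrow> 'm \<Rightarrow> ('m, 'n) tensor \<Rightarrow> ('m, 'n) tensor) \<Rightarrow> bool" where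
  "C1_transport X \<A> L \<longleftrightarrow>
     (\<exists>E E' H. frame_field X \<A> E \<and> dual_frame_field X \<A> E E' \<and>
        (\<forall>x\<in>topspace X. \<forall>y\<in>topspace X. \<forall>j.
           L x y (E x j) = tlincomb (\<lambda>i. H y x $ i $ j) (E y)) \<and>
        C1_bivector \<A> E E' H \<and>
        C1_bivector \<A> E E' (\<lambda>x y. matrix_inv (H y x)))"


section \<open>Linear connections\<close>

definition linear_connection ::
  "'m topology \<Rightarrow> ('m, 'n::finite) chart set \<Rightarrow>
   (('m \<Rightarrow> ('m, 'n) tensor) \<Rightarrow> ('m \<Rightarrow> ('m, 'n) tensor) \<Rightarrow> ('m \<Rightarrow> ('m, 'n) tensor)) \<Rightarrow> bool" where
  "linear_connection X \<A> D \<longleftrightarrow>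
     (\<forall>V. tensor_field X \<A> 1 0 V \<longrightarrow>
        (\<forall>p q A. C1_tensor_field X \<A> p q A \<longrightarrow> tensor_field X \<A> p q (D V A)) \<and>
        (\<forall>p q r s A. r < p \<longrightarrow> s < q \<longrightarrow> C1_tensor_field X \<A> p q A \<longrightarrow>
           (\<forall>x\<in>topspace X. D V (\<lambda>y. tcontract r s (A y)) x = tcontract r s (D V A x))) \<and>
        (\<forall>p q p' q' A B. C1_tensor_field X \<A> p q A \<longrightarrow> C1_tensor_field X \<A> p' q' B \<longrightarrow>
           (\<forall>x\<in>topspace X. D V (\<lambda>y. tprod (A y) (B y)) x =
              tadd (tprod (D V A x) (B x)) (tprod (A x) (D V B x)))) \<and>
        (\<forall>p q A A'. C1_tensor_field X \<A> p q A \<longrightarrow> C1_tensor_field X \<A> p q A' \<longrightarrow>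
           (\<forall>x\<in>topspace X. D V (\<lambda>y. tadd (A y) (A' y)) x = tadd (D V A x) (D V A' x)))) \<and>
     (\<forall>V f. tensor_field X \<A> 1 0 V \<longrightarrow> C1_function \<A> f \<longrightarrow>
        (\<forall>x\<in>topspace X. \<forall>c\<in>charts_at \<A> x.
           D V (\<lambda>y. tscalar \<A> y (f y)) x = tscalar \<A> x (vf_deriv c V f x))) \<and>
     (\<forall>V W p q A. tensor_field X \<A> 1 0 V \<longrightarrow> tensor_field X \<A> 1 0 W \<longrightarrow>
        C1_tensor_field X \<A> p q A \<longrightarrow>
        (\<forall>x\<in>topspace X. D (\<lambda>y. tadd (V y) (W y)) A x = tadd (D V A x) (D W A x))) \<and>
     (\<forall>f V p q A. C1_function \<A> f \<longrightarrow> tensor_field X \<A> 1 0 V \<longrightarrow> C1_tensor_field X \<A> p q A \<longrightarrow>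
        (\<forall>x\<in>topspace X. D (\<lambda>y. tscale (f y) (V y)) A x = tscale (f x) (D V A x)))"

definition displaced ::
  "('m, 'n::finite) chart \<Rightarrow> ('m \<Rightarrow> ('m, 'n) tensor) \<Rightarrow> 'm \<Rightarrow> real \<Rightarrow> 'm" where
  "displaced c V x \<epsilon> = chart_inv c (snd c x + \<epsilon> *\<^sub>R vector_components (V x) c)"

text \<open>\<open>T\<close> is the limit of the difference quotients formed in the coordinates of \<open>c\<close>. The spaces
  \<open>tensors_at \<A> x p q\<close> are finite-dimensional, so convergence is convergence of components.\<close>

definition has_transport_derivative ::
  "('m \<Rightarrow> 'm \<Rightarrow> ('m, 'n) tensor \<Rightarrow> ('m, 'n) tensor) \<Rightarrow> ('m, 'n::finite) chart \<Rightarrow>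
   ('m \<Rightarrow> ('m, 'n) tensor) \<Rightarrow> ('m \<Rightarrow> ('m, 'n) tensor) \<Rightarrow> 'm \<Rightarrow> ('m, 'n) tensor \<Rightarrow> bool" where
  "has_transport_derivative L c V S x T \<longleftrightarrow>
     (\<forall>d I J. ((\<lambda>\<epsilon>. (1 / \<epsilon>) *
        (L (displaced c V x \<epsilon>) x (S (displaced c V x \<epsilon>)) d I J - S x d I J))
        \<longlongrightarrow> T d I J) (at 0))"

definition nabla ::
  "('m, 'n::finite) chart set \<Rightarrow> ('m \<Rightarrow> 'm \<Rightarrow> ('m, 'n) tensor \<Rightarrow> ('m, 'n) tensor) \<Rightarrow>
   ('m \<Rightarrow> ('m, 'n) tensor) \<Rightarrow> ('m \<Rightarrow> ('m, 'n) tensor) \<Rightarrow> ('m \<Rightarrow> ('m, 'n) tensor)" where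
  "nabla \<A> L V S x = (THE T. \<exists>c\<in>charts_at \<A> x. has_transport_derivative L c V S x T)"

end

theory Submission
  imports Defs
begin

text \<open>
  Fix a point \<open>x\<close>. Because \<open>L\<close> carries every tensor to the one space of tensors at \<open>x\<close>, a tensor
  field \<open>S\<close> becomes the ordinary function \<open>y \<mapsto> L y x (S y)\<close> with values in a finite-dimensional
  vector space, and \<open>\<nabla>\<^sub>V S\<close> at \<open>x\<close> is the directional derivative of this function along \<open>V x\<close>. Once
  the function is known to be differentiable at \<open>x\<close>, every claim is a rule of calculus: the
  differential at \<open>x\<close> is linear, so the derivative is additive and homogeneous in \<open>V\<close>; the chain rule
  and the transformation law of \<open>V x\<close> show that it does not depend on the chart
  (\<open>pullback_derivative_chart_independent\<close>); and \<open>L y x\<close> commutes with sums, tensor products and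
  contractions, which are linear or bilinear in the components, so that additivity, the Leibniz rule
  and the commutation with contractions follow from the corresponding rules for real derivatives.

  What needs work is differentiability (\<open>pullback_differentiable\<close>), since the smoothness of \<open>L\<close>
  is a condition on tangent vectors only. The algebraic axioms determine \<open>L\<close> on all tensors
  from its action on vectors: \<open>L\<close> is the identity on scalars, because it is multiplicative and
  invertible (\<open>L_tscalar\<close>); hence it preserves the pairing of vectors with covectors, so that it
  acts on covectors from \<open>y\<close> to \<open>x\<close> through its action on vectors from \<open>x\<close> to \<open>y\<close>
  (\<open>L_coord_covector\<close>). A tensor is a sum of products of coordinate vectors and covectors with
  tensors of lower type, whence by induction \<open>L y x\<close> acts on components by the classical formula
  with one matrix factor for each index (\<open>L_component\<close>). All matrix entries in
  this formula are components of the bivector of \<open>L\<close> with one of its two points kept at \<open>x\<close>, and the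
  bivector is \<open>C\<^sup>1\<close>.
\<close>


section \<open>Changing frames in a table of components\<close>

text \<open>This is the transformation law of tensor components, with unrelated matrices for the upper and the
lower indices. For a pair of mutually inverse Jacobians it describes a change of coordinates; for the
matrices of a transport on vectors and covectors it describes the transport of an arbitrary tensor.\<close>

definition change_frame ::
  "('n::finite \<Rightarrow> 'n \<Rightarrow> real) \<Rightarrow> ('n \<Rightarrow> 'n \<Rightarrow> real) \<Rightarrow> nat \<Rightarrow> nat \<Rightarrow>
   ('n list \<Rightarrow> 'n list \<Rightarrow> real) \<Rightarrow> 'n list \<Rightarrow> 'n list \<Rightarrow> real" where
  "change_frame a b p q T I J =
     (\<Sum>K\<in>{K. length K = p}. \<Sum>L\<in>{L. length L = q}.
        (\<Prod>r<p. a (I ! r) (K ! r)) * (\<Prod>s<q. b (L ! s) (J ! s)) * T K L)"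

lemma sum_Kronecker:
  fixes f :: "'n::finite \<Rightarrow> real"
  shows "(\<Sum>k\<in>UNIV. f k * (if k = j then 1 else 0)) = f j"
    and "(\<Sum>k\<in>UNIV. f k * (if j = k then 1 else 0)) = f j"
    and "(\<Sum>k\<in>UNIV. (if k = j then 1 else 0) * f k) = f j"
    and "(\<Sum>k\<in>UNIV. (if j = k then 1 else 0) * f k) = f j"
  by (simp_all add: mult_delta_left mult_delta_right)

lemma double_sum_single:
  fixes f :: "'i \<Rightarrow> 'j \<Rightarrow> real"
  assumes "finite A" "finite B" "i \<in> A" "j \<in> B"
    and "\<And>i' j'. i' \<in> A \<Longrightarrow> j' \<in> B \<Longrightarrow> i' \<noteq> i \<or> j' \<noteq> j \<Longrightarrow> f i' j' = 0"
  shows "(\<Sum>i\<in>A. \<Sum>j\<in>B. f i j) = f i j"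
proof -
  have "(\<Sum>i\<in>A. \<Sum>j\<in>B. f i j) = (\<Sum>(i, j)\<in>A \<times> B. f i j)"
    by (rule sum.cartesian_product)
  also have "\<dots> = (\<Sum>(i, j)\<in>{(i, j)}. f i j)"
    using assms by (intro sum.mono_neutral_right) auto
  finally show ?thesis by simp
qed

text \<open>A contraction does not see a change of frame if the two indices change by mutually inverse matrices.\<close>

lemma contraction_invariant:
  fixes a b :: "'k::finite \<Rightarrow> 'k \<Rightarrow> real"
  assumes "\<And>n m. (\<Sum>k\<in>UNIV. b n k * a k m) = (if n = m then 1 else 0)"
  shows "(\<Sum>k\<in>UNIV. (\<Sum>m\<in>UNIV. a k m * f m) * (\<Sum>n\<in>UNIV. b n k * g n)) =
    (\<Sum>m\<in>UNIV. f m * g m)"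
proof -
  have "(\<Sum>k\<in>UNIV. (\<Sum>m\<in>UNIV. a k m * f m) * (\<Sum>n\<in>UNIV. b n k * g n)) =
      (\<Sum>k\<in>UNIV. \<Sum>m\<in>UNIV. \<Sum>n\<in>UNIV. b n k * a k m * f m * g n)"
    by (simp add: sum_product mult_ac)
  also have "\<dots> = (\<Sum>m\<in>UNIV. \<Sum>k\<in>UNIV. \<Sum>n\<in>UNIV. b n k * a k m * f m * g n)"
    by (rule sum.swap)
  also have "\<dots> = (\<Sum>m\<in>UNIV. \<Sum>n\<in>UNIV. \<Sum>k\<in>UNIV. b n k * a k m * f m * g n)"
    by (intro sum.cong refl sum.swap)
  also have "\<dots> = (\<Sum>m\<in>UNIV. \<Sum>n\<in>UNIV. (if n = m then 1 else 0) * f m * g n)"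
    by (simp add: sum_distrib_right[symmetric] assms)
  also have "\<dots> = (\<Sum>m\<in>UNIV. f m * g m)"
    by (simp add: sum_Kronecker mult.assoc)
  finally show ?thesis .
qed

lemma finite_lists_of_length: "finite {K :: 'n::finite list. length K = p}"
  using finite_lists_length_eq[OF finite[of UNIV], of p] by simp

lemma sum_lists_Suc:
  fixes f :: "'n::finite list \<Rightarrow> real"
  shows "(\<Sum>K\<in>{K. length K = Suc p}. f K) = (\<Sum>k\<in>UNIV. \<Sum>K\<in>{K. length K = p}. f (k # K))"
proof -
  have "{K :: 'n list. length K = Suc p} = (\<lambda>(k, K). k # K) ` (UNIV \<times> {K. length K = p})"
    by (auto simp: length_Suc_conv image_iff)
  moreover have "inj_on (\<lambda>(k :: 'n, K). k # K) (UNIV \<times> {K. length K = p})"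
    by (auto simp: inj_on_def)
  ultimately show ?thesis
    by (simp add: sum.reindex sum.cartesian_product case_prod_unfold)
qed

lemma change_frame_0: "change_frame a b 0 0 T [] [] = T [] []"
  by (simp add: change_frame_def)

text \<open>Splitting off the first upper or the first lower index is the step of all inductions on the type of
a tensor.\<close>

lemma change_frame_Cons_upper:
  "change_frame a b (Suc p) q T (i # I) J =
     (\<Sum>k\<in>UNIV. a i k * change_frame a b p q (\<lambda>K. T (k # K)) I J)"
  by (simp add: change_frame_def sum_lists_Suc prod.lessThan_Suc_shift sum_distrib_left
      mult.assoc del: prod.lessThan_Suc)

lemma change_frame_Cons_lower:
  "change_frame a b p (Suc q) T I (j # J) =
     (\<Sum>l\<in>UNIV. b l j * change_frame a b p q (\<lambda>K L. T K (l # L)) I J)"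
proof -
  have "change_frame a b p (Suc q) T I (j # J) = (\<Sum>K\<in>{K. length K = p}. \<Sum>l\<in>UNIV.
      \<Sum>L\<in>{L. length L = q}. b l j * ((\<Prod>r<p. a (I ! r) (K ! r)) * (\<Prod>s<q. b (L ! s) (J ! s)) * T K (l # L)))"
    by (simp add: change_frame_def sum_lists_Suc prod.lessThan_Suc_shift mult_ac del: prod.lessThan_Suc)
  also have "\<dots> = (\<Sum>l\<in>UNIV. \<Sum>K\<in>{K. length K = p}.
      \<Sum>L\<in>{L. length L = q}. b l j * ((\<Prod>r<p. a (I ! r) (K ! r)) * (\<Prod>s<q. b (L ! s) (J ! s)) * T K (l # L)))"
    by (rule sum.swap)
  finally show ?thesis
    by (simp add: change_frame_def sum_distrib_left)
qed

lemma change_frame_add: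
  "change_frame a b p q (\<lambda>K L. S K L + T K L) I J =
     change_frame a b p q S I J + change_frame a b p q T I J"
  by (simp add: change_frame_def distrib_left sum.distrib)

lemma change_frame_scale:
  "change_frame a b p q (\<lambda>K L. x * T K L) I J = x * change_frame a b p q T I J"
  by (simp add: change_frame_def sum_distrib_left mult_ac)

lemma change_frame_sum:
  "change_frame a b p q (\<lambda>K L. \<Sum>m\<in>M. f m * T m K L) I J =
     (\<Sum>m\<in>M. f m * change_frame a b p q (T m) I J)"
  by (induction M rule: infinite_finite_induct)
     (simp_all add: change_frame_add change_frame_scale, simp_all add: change_frame_def)


section \<open>Jacobians of coordinate changes\<close>

lemma has_derivative_cong_nhds:
  assumes "\<forall>\<^sub>F u in nhds a. f u = g u" "(f has_derivative D) (at a)"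
  shows "(g has_derivative D) (at a)"
proof -
  obtain S where "open S" "a \<in> S" "\<And>u. u \<in> S \<Longrightarrow> f u = g u"
    using assms(1) unfolding eventually_nhds by blast
  then show ?thesis
    using has_derivative_transform_within_open[OF assms(2)] by blast
qed

lemma has_real_derivative_cong_nhds:
  fixes f g :: "real \<Rightarrow> real"
  assumes "\<forall>\<^sub>F u in nhds a. f u = g u" "(f has_real_derivative D) (at a)"
  shows "(g has_real_derivative D) (at a)"
  using assms unfolding has_field_derivative_def by (rule has_derivative_cong_nhds)

locale C1_atlas =
  fixes X :: "'m topology" and \<A> :: "('m, 'n::finite) chart set"
  assumes manifold: "C1_manifold X \<A>"
begin

lemma chart_openin: "c \<in> \<A> \<Longrightarrow> openin X (fst c)"
  using manifold by (auto simp: C1_manifold_def)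

lemma charts_atD: "c \<in> charts_at \<A> x \<Longrightarrow> c \<in> \<A>" "c \<in> charts_at \<A> x \<Longrightarrow> x \<in> fst c"
  by (auto simp: charts_at_def)

lemma chart_in_topspace: "c \<in> \<A> \<Longrightarrow> x \<in> fst c \<Longrightarrow> x \<in> topspace X"
  using chart_openin openin_subset by blast

lemma charts_at_topspace: "c \<in> charts_at \<A> x \<Longrightarrow> x \<in> topspace X"
  using chart_in_topspace charts_atD by blast

lemma charts_at_nonempty: "x \<in> topspace X \<Longrightarrow> \<exists>c. c \<in> charts_at \<A> x"
  using manifold by (fastforce simp: C1_manifold_def charts_at_def)

lemma chart_homeo:
  "c \<in> \<A> \<Longrightarrow> homeomorphic_map (subtopology X (fst c)) (top_of_set (snd c ` fst c)) (snd c)"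
  using manifold by (auto simp: C1_manifold_def)

lemma topspace_chart: "c \<in> \<A> \<Longrightarrow> topspace (subtopology X (fst c)) = fst c"
  by (simp add: Int_absorb1 chart_openin openin_subset)

lemma chart_inv_coords: "c \<in> \<A> \<Longrightarrow> x \<in> fst c \<Longrightarrow> chart_inv c (snd c x) = x"
  using homeomorphic_imp_injective_map[OF chart_homeo] topspace_chart
  by (simp add: chart_inv_def inv_into_f_f)

lemma chart_inv_in: "u \<in> snd c ` U \<Longrightarrow> c \<in> \<A> \<Longrightarrow> U \<subseteq> fst c \<Longrightarrow> chart_inv c u \<in> U"
  using chart_inv_coords by fastforce

lemma open_overlap:
  assumes "c \<in> \<A>" "d \<in> \<A>"
  shows "open (snd c ` (fst c \<inter> fst d))"
proof -
  have "openin (subtopology X (fst c)) (fst c \<inter> fst d)"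
    using assms chart_openin by (simp add: openin_subtopology_Int2)
  then have "openin (top_of_set (snd c ` fst c)) (snd c ` (fst c \<inter> fst d))"
    using homeomorphic_imp_open_map[OF chart_homeo[OF assms(1)]] by (auto simp: open_map_def)
  moreover have "open (snd c ` fst c)"
    using manifold assms by (auto simp: C1_manifold_def)
  ultimately show ?thesis
    using openin_open_eq by blast
qed

lemma open_chart: "c \<in> \<A> \<Longrightarrow> open (snd c ` fst c)"
  using open_overlap[of c c] by simp

text \<open>The overlap of two charts is open in the coordinates of either, so all coordinates close to those of
\<open>x\<close> belong to a point of the overlap.\<close>

lemma eventually_in_chart:
  assumes "c \<in> charts_at \<A> x" "d \<in> charts_at \<A> x"
  shows "\<forall>\<^sub>F u in nhds (snd c x). chart_inv c u \<in> fst c \<inter> fst d \<and> snd c (chart_inv c u) = u"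
proof -
  have "\<forall>\<^sub>F u in nhds (snd c x). u \<in> snd c ` (fst c \<inter> fst d)"
    using assms open_overlap[of c d] by (intro eventually_nhds_in_open) (auto simp: charts_at_def)
  then show ?thesis
    using assms by (auto elim!: eventually_mono simp: charts_at_def chart_inv_coords)
qed

lemma transition_has_derivative:
  assumes "c \<in> charts_at \<A> x" "d \<in> charts_at \<A> x"
  shows "((snd d \<circ> chart_inv c) has_derivative (\<lambda>h. \<chi> i. \<Sum>k\<in>UNIV. jacobian c d x i k * h $ k))
           (at (snd c x))"
proof -
  let ?D = "frechet_derivative (snd d \<circ> chart_inv c) (at (snd c x))"
  have "C1_on (snd d \<circ> chart_inv c) (snd c ` (fst c \<inter> fst d))"
    using manifold assms by (auto simp: C1_manifold_def charts_at_def)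
  then have "(snd d \<circ> chart_inv c) differentiable at (snd c x)"
    using assms unfolding C1_on_def charts_at_def differentiable_def by blast
  then have D: "((snd d \<circ> chart_inv c) has_derivative ?D) (at (snd c x))"
    by (simp add: frechet_derivative_works)
  then have "?D h = matrix ?D *v h" for h
    by (simp add: has_derivative_linear matrix_works)
  then have "?D = (\<lambda>h. \<chi> i. \<Sum>k\<in>UNIV. jacobian c d x i k * h $ k)"
    by (auto simp: matrix_vector_mult_def jacobian_def)
  with D show ?thesis by simp
qed

text \<open>The coordinate change from \<open>c\<close> to \<open>e\<close> factors through \<open>d\<close> near \<open>x\<close>.\<close>

lemma jacobian_chain:
  assumes "c \<in> charts_at \<A> x" "d \<in> charts_at \<A> x" "e \<in> charts_at \<A> x"
  shows "(\<Sum>k\<in>UNIV. jacobian d e x i k * jacobian c d x k j) = jacobian c e x i j"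
proof -
  let ?M = "\<lambda>c d h. \<chi> i. \<Sum>k\<in>UNIV. jacobian c d x i k * h $ k"
  have "snd d x = (snd d \<circ> chart_inv c) (snd c x)"
    using assms by (simp add: charts_at_def chart_inv_coords)
  then have "((snd e \<circ> chart_inv d) has_derivative ?M d e) (at ((snd d \<circ> chart_inv c) (snd c x)))"
    using transition_has_derivative[OF assms(2,3)] by simp
  from diff_chain_at[OF transition_has_derivative[OF assms(1,2)] this]
  have "((snd e \<circ> chart_inv d \<circ> (snd d \<circ> chart_inv c)) has_derivative ?M d e \<circ> ?M c d)
      (at (snd c x))" .
  moreover have "\<forall>\<^sub>F u in nhds (snd c x).
      (snd e \<circ> chart_inv d \<circ> (snd d \<circ> chart_inv c)) u = (snd e \<circ> chart_inv c) u"
    using eventually_in_chart[OF assms(1,2)] assms(2)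
    by (auto elim!: eventually_mono simp: charts_at_def chart_inv_coords)
  ultimately have "((snd e \<circ> chart_inv c) has_derivative ?M d e \<circ> ?M c d) (at (snd c x))"
    using has_derivative_cong_nhds by blast
  from has_derivative_unique[OF this transition_has_derivative[OF assms(1,3)]]
  \<comment> \<open>Evaluating the two differentials at a basis vector compares the matrix entries.\<close>
  have "?M d e (?M c d (axis j 1)) $ i = ?M c e (axis j 1) $ i"
    by (metis comp_apply)
  then show ?thesis
    by (simp add: axis_def sum_Kronecker)
qed

lemma jacobian_chain_commuted:
  assumes "c \<in> charts_at \<A> x" "d \<in> charts_at \<A> x" "e \<in> charts_at \<A> x"
  shows "(\<Sum>k\<in>UNIV. jacobian c d x k j * jacobian d e x i k) = jacobian c e x i j"
  using jacobian_chain[OF assms] by (simp add: mult.commute)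

lemma jacobian_self:
  assumes "c \<in> charts_at \<A> x"
  shows "jacobian c c x i j = (if i = j then 1 else 0)"
proof -
  have "((\<lambda>u. u) has_derivative (\<lambda>h. h)) (at (snd c x))"
    by (rule has_derivative_ident)
  moreover have "\<forall>\<^sub>F u in nhds (snd c x). u = (snd c \<circ> chart_inv c) u"
    using eventually_in_chart[OF assms assms] by (auto elim!: eventually_mono)
  ultimately have "((snd c \<circ> chart_inv c) has_derivative (\<lambda>h. h)) (at (snd c x))"
    by (rule has_derivative_cong_nhds[rotated])
  from has_derivative_unique[OF this transition_has_derivative[OF assms assms]]
  have "axis j 1 $ i = (\<chi> i. \<Sum>k\<in>UNIV. jacobian c c x i k * axis j 1 $ k) $ i"
    by metis
  then show ?thesis
    by (simp add: axis_def sum_Kronecker)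
qed

lemma jacobian_inverse:
  assumes "c \<in> charts_at \<A> x" "d \<in> charts_at \<A> x"
  shows "(\<Sum>k\<in>UNIV. jacobian d c x i k * jacobian c d x k j) = (if i = j then 1 else 0)"
  using jacobian_chain[OF assms assms(1)] jacobian_self[OF assms(1)] by simp


section \<open>Tensors at a point\<close>

lemma tensors_at_iff:
  "T \<in> tensors_at \<A> x p q \<longleftrightarrow>
     (\<forall>c I J. T c I J \<noteq> 0 \<longrightarrow> c \<in> charts_at \<A> x \<and> length I = p \<and> length J = q) \<and>
     (\<forall>c\<in>charts_at \<A> x. \<forall>d\<in>charts_at \<A> x. \<forall>I J. length I = p \<longrightarrow> length J = q \<longrightarrow>
        T d I J = change_frame (jacobian c d x) (jacobian d c x) p q (T c) I J)"
  by (simp add: tensors_at_def change_frame_def)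

lemma tensors_atI:
  assumes "\<And>c I J. T c I J \<noteq> 0 \<Longrightarrow> c \<in> charts_at \<A> x \<and> length I = p \<and> length J = q"
    and "\<And>c d I J. c \<in> charts_at \<A> x \<Longrightarrow> d \<in> charts_at \<A> x \<Longrightarrow> length I = p \<Longrightarrow> length J = q \<Longrightarrow>
      T d I J = change_frame (jacobian c d x) (jacobian d c x) p q (T c) I J"
  shows "T \<in> tensors_at \<A> x p q"
  unfolding tensors_at_iff using assms by blast

lemma tensor_support:
  "T \<in> tensors_at \<A> x p q \<Longrightarrow> \<not> (d \<in> charts_at \<A> x \<and> length I = p \<and> length J = q) \<Longrightarrow> T d I J = 0"
  unfolding tensors_at_iff by blast

lemma tensor_transform:
  "T \<in> tensors_at \<A> x p q \<Longrightarrow> c \<in> charts_at \<A> x \<Longrightarrow> d \<in> charts_at \<A> x \<Longrightarrow>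
     length I = p \<Longrightarrow> length J = q \<Longrightarrow>
     T d I J = change_frame (jacobian c d x) (jacobian d c x) p q (T c) I J"
  unfolding tensors_at_iff by blast

lemma vector_transform:
  assumes "v \<in> tensors_at \<A> x 1 0" "c \<in> charts_at \<A> x" "d \<in> charts_at \<A> x"
  shows "v d [i] [] = (\<Sum>k\<in>UNIV. jacobian c d x i k * v c [k] [])"
  using tensor_transform[OF assms, of "[i]" "[]"]
  by (simp add: change_frame_Cons_upper change_frame_0)

lemma covector_transform:
  assumes "w \<in> tensors_at \<A> x 0 1" "c \<in> charts_at \<A> x" "d \<in> charts_at \<A> x"
  shows "w d [] [j] = (\<Sum>k\<in>UNIV. jacobian d c x k j * w c [] [k])"
  using tensor_transform[OF assms, of "[]" "[j]"]
  by (simp add: change_frame_Cons_lower change_frame_0)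

lemma tensors_at_sum:
  assumes "\<And>m. m \<in> M \<Longrightarrow> T m \<in> tensors_at \<A> x p q"
  shows "(\<lambda>c I J. \<Sum>m\<in>M. f m * T m c I J) \<in> tensors_at \<A> x p q"
proof (rule tensors_atI)
  fix c I J assume "(\<Sum>m\<in>M. f m * T m c I J) \<noteq> 0"
  then obtain m where "m \<in> M" "f m * T m c I J \<noteq> 0"
    using sum.not_neutral_contains_not_neutral by blast
  then show "c \<in> charts_at \<A> x \<and> length I = p \<and> length J = q"
    using tensor_support[OF assms] by fastforce
next
  fix c d and I J :: "'n list"
  assume "c \<in> charts_at \<A> x" "d \<in> charts_at \<A> x" "length I = p" "length J = q"
  then have "T m d I J = change_frame (jacobian c d x) (jacobian d c x) p q (T m c) I J"
    if "m \<in> M" for m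
    using tensor_transform[OF assms[OF that]] by blast
  then show "(\<Sum>m\<in>M. f m * T m d I J) =
      change_frame (jacobian c d x) (jacobian d c x) p q (\<lambda>I J. \<Sum>m\<in>M. f m * T m c I J) I J"
    by (simp add: change_frame_sum)
qed

lemma tzero_in_tensors_at: "tzero \<in> tensors_at \<A> x p q"
  using tensors_at_sum[of "{}" "\<lambda>_. tzero" x p q "\<lambda>_. 0"] by (simp add: tzero_def)

lemma tscale_in_tensors_at: "T \<in> tensors_at \<A> x p q \<Longrightarrow> tscale a T \<in> tensors_at \<A> x p q"
  using tensors_at_sum[of "{()}" "\<lambda>_. T" x p q "\<lambda>_. a"] by (simp add: tscale_def)

lemma tadd_in_tensors_at:
  assumes "S \<in> tensors_at \<A> x p q" "T \<in> tensors_at \<A> x p q"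
  shows "tadd S T \<in> tensors_at \<A> x p q"
  using tensors_at_sum[of UNIV "\<lambda>b. if b then S else T" x p q "\<lambda>_. 1"] assms
  by (simp add: tadd_def UNIV_bool add.commute)

text \<open>The group laws of a flat transport are stated on the whole tensor algebra; this makes them available
for tensors of a fixed type.\<close>

lemma tensors_at_subset_algebra:
  assumes "T \<in> tensors_at \<A> x p q"
  shows "T \<in> tensor_algebra \<A> x"
proof -
  have *: "tpart p' q' T = (if p' = p \<and> q' = q then T else tzero)" for p' q'
  proof (intro ext)
    fix d I J
    show "tpart p' q' T d I J = (if p' = p \<and> q' = q then T else tzero) d I J"
      using tensor_support[OF assms, of d I J] by (auto simp: tpart_def tzero_def)
  qed
  have "{(p', q'). tpart p' q' T \<noteq> tzero} \<subseteq> {(p, q)}"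
    by (auto simp: * split: if_splits)
  then show ?thesis
    using assms tzero_in_tensors_at by (auto simp: tensor_algebra_def * intro: finite_subset)
qed

text \<open>The space of tensors is cut out by linear equations between finitely many components, so it contains
the componentwise limits of its elements. A limit of difference quotients of tensors
is therefore a tensor.\<close>

lemma tensors_at_limit:
  assumes "F \<noteq> bot" and ev: "\<forall>\<^sub>F e in F. T e \<in> tensors_at \<A> x p q"
    and lim: "\<And>d I J. ((\<lambda>e. T e d I J) \<longlongrightarrow> T0 d I J) F"
  shows "T0 \<in> tensors_at \<A> x p q"
proof (rule tensors_atI)
  fix d I J assume "T0 d I J \<noteq> 0"
  moreover have "T0 d I J = 0" if "\<not> (d \<in> charts_at \<A> x \<and> length I = p \<and> length J = q)"
  proof -
    have "\<forall>\<^sub>F e in F. T e d I J = 0"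
      using ev by eventually_elim (rule tensor_support[OF _ that])
    then have "((\<lambda>e. T e d I J) \<longlongrightarrow> 0) F"
      by (rule tendsto_eventually)
    then show ?thesis
      using tendsto_unique[OF assms(1) lim] by blast
  qed
  ultimately show "d \<in> charts_at \<A> x \<and> length I = p \<and> length J = q" by blast
next
  fix c d and I J :: "'n list"
  assume *: "c \<in> charts_at \<A> x" "d \<in> charts_at \<A> x" "length I = p" "length J = q"
  let ?C = "\<lambda>T. change_frame (jacobian c d x) (jacobian d c x) p q (T c) I J"
  have "((\<lambda>e. ?C (T e)) \<longlongrightarrow> ?C T0) F"
    unfolding change_frame_def by (intro tendsto_intros lim)
  moreover have "\<forall>\<^sub>F e in F. ?C (T e) = T e d I J"
    using ev by eventually_elim (rule tensor_transform[OF _ *, symmetric])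
  ultimately have "((\<lambda>e. T e d I J) \<longlongrightarrow> ?C T0) F"
    by (rule Lim_transform_eventually)
  then show "T0 d I J = ?C T0"
    using tendsto_unique[OF assms(1) lim] by blast
qed

text \<open>In a product with a factor of type \<open>(1,0)\<close>, \<open>(0,1)\<close> or \<open>(0,0)\<close> on the left, at most one
splitting of the index lists contributes.\<close>

lemma tprod_vector_Nil: "v \<in> tensors_at \<A> x 1 0 \<Longrightarrow> tprod v B d [] J = 0"
  by (simp add: tprod_def tensor_support)

lemma tprod_vector_Cons:
  assumes "v \<in> tensors_at \<A> x 1 0"
  shows "tprod v B d (i # I) J = v d [i] [] * B d I J"
  unfolding tprod_def
  by (subst double_sum_single[of _ _ 1 0]) (auto intro!: tensor_support[OF assms])

lemma tprod_covector_Nil: "w \<in> tensors_at \<A> x 0 1 \<Longrightarrow> tprod w B d I [] = 0"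
  by (simp add: tprod_def tensor_support)

lemma tprod_covector_Cons:
  assumes "w \<in> tensors_at \<A> x 0 1"
  shows "tprod w B d I (j # J) = w d [] [j] * B d I J"
  unfolding tprod_def
  by (subst double_sum_single[of _ _ 0 1]) (auto intro!: tensor_support[OF assms])

lemma tprod_scalar:
  "tprod (tscalar \<A> x a) T d I J = (if d \<in> charts_at \<A> x then a * T d I J else 0)"
  unfolding tprod_def
  by (subst double_sum_single[of _ _ 0 0]) (auto simp: tscalar_def)

lemma tprod_vector_in_tensors_at:
  assumes v: "v \<in> tensors_at \<A> x 1 0" and B: "B \<in> tensors_at \<A> x p q"
  shows "tprod v B \<in> tensors_at \<A> x (Suc p) q"
proof (rule tensors_atI)
  fix d I J assume "tprod v B d I J \<noteq> 0"
  then show "d \<in> charts_at \<A> x \<and> length I = Suc p \<and> length J = q"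
    using tensor_support[OF v, of d] tensor_support[OF B, of d]
    by (cases I) (auto simp: tprod_vector_Nil[OF v] tprod_vector_Cons[OF v])
next
  fix c d and I J :: "'n list"
  assume *: "c \<in> charts_at \<A> x" "d \<in> charts_at \<A> x" "length I = Suc p" "length J = q"
  then obtain i I' where I: "I = i # I'" "length I' = p" by (auto simp: length_Suc_conv)
  show "tprod v B d I J = change_frame (jacobian c d x) (jacobian d c x) (Suc p) q (tprod v B c) I J"
    unfolding I change_frame_Cons_upper tprod_vector_Cons[OF v] change_frame_scale
    using vector_transform[OF v *(1,2)] tensor_transform[OF B *(1,2) I(2) *(4)]
    by (simp add: sum_distrib_right mult.assoc)
qed

lemma tprod_covector_in_tensors_at:
  assumes w: "w \<in> tensors_at \<A> x 0 1" and B: "B \<in> tensors_at \<A> x p q"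
  shows "tprod w B \<in> tensors_at \<A> x p (Suc q)"
proof (rule tensors_atI)
  fix d I J assume "tprod w B d I J \<noteq> 0"
  then show "d \<in> charts_at \<A> x \<and> length I = p \<and> length J = Suc q"
    using tensor_support[OF w, of d] tensor_support[OF B, of d]
    by (cases J) (auto simp: tprod_covector_Nil[OF w] tprod_covector_Cons[OF w])
next
  fix c d and I J :: "'n list"
  assume *: "c \<in> charts_at \<A> x" "d \<in> charts_at \<A> x" "length I = p" "length J = Suc q"
  then obtain j J' where J: "J = j # J'" "length J' = q" by (auto simp: length_Suc_conv)
  show "tprod w B d I J = change_frame (jacobian c d x) (jacobian d c x) p (Suc q) (tprod w B c) I J"
    unfolding J change_frame_Cons_lower tprod_covector_Cons[OF w] change_frame_scale
    using covector_transform[OF w *(1,2)] tensor_transform[OF B *(1,2,3) J(2)]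
    by (simp add: sum_distrib_right mult.assoc)
qed

text \<open>Multiplying by a vector and contracting inserts the vector into the first covariant argument;
for a covector and the first contravariant argument likewise. Inserting coordinate vectors and
covectors isolates the slices of a table of components.\<close>

lemma contract_vector_component:
  assumes "v \<in> tensors_at \<A> x 1 0"
  shows "tcontract 0 0 (tprod v T) d I J = (\<Sum>k\<in>UNIV. v d [k] [] * T d I (k # J))"
  by (simp add: tcontract_def tprod_vector_Cons[OF assms])

lemma contract_covector_component:
  assumes "w \<in> tensors_at \<A> x 0 1"
  shows "tcontract 0 0 (tprod w T) d I J = (\<Sum>k\<in>UNIV. w d [] [k] * T d (k # I) J)"
  by (simp add: tcontract_def tprod_covector_Cons[OF assms])

lemma contract_vector_in_tensors_at:
  assumes v: "v \<in> tensors_at \<A> x 1 0" and T: "T \<in> tensors_at \<A> x p (Suc q)"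
  shows "tcontract 0 0 (tprod v T) \<in> tensors_at \<A> x p q"
proof (rule tensors_atI)
  fix d I J assume "tcontract 0 0 (tprod v T) d I J \<noteq> 0"
  then obtain k where "v d [k] [] * T d I (k # J) \<noteq> 0"
    unfolding contract_vector_component[OF v] using sum.not_neutral_contains_not_neutral by blast
  then show "d \<in> charts_at \<A> x \<and> length I = p \<and> length J = q"
    using tensor_support[OF T, of d I "k # J"] by auto
next
  fix c d and I J :: "'n list"
  assume *: "c \<in> charts_at \<A> x" "d \<in> charts_at \<A> x" "length I = p" "length J = q"
  let ?C = "change_frame (jacobian c d x) (jacobian d c x)"
  have "T d I (k # J) = ?C p (Suc q) (T c) I (k # J)" for k
    using tensor_transform[OF T *(1,2,3)] *(4) by simp
  then have "tcontract 0 0 (tprod v T) d I J =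
      (\<Sum>m\<in>UNIV. v c [m] [] * ?C p q (\<lambda>K L. T c K (m # L)) I J)"
    unfolding contract_vector_component[OF v] vector_transform[OF v *(1,2)]
    by (simp add: change_frame_Cons_lower contraction_invariant[OF jacobian_inverse[OF *(1,2)]])
  then show "tcontract 0 0 (tprod v T) d I J = ?C p q (tcontract 0 0 (tprod v T) c) I J"
    unfolding contract_vector_component[OF v] change_frame_sum .
qed

lemma contract_covector_in_tensors_at:
  assumes w: "w \<in> tensors_at \<A> x 0 1" and T: "T \<in> tensors_at \<A> x (Suc p) q"
  shows "tcontract 0 0 (tprod w T) \<in> tensors_at \<A> x p q"
proof (rule tensors_atI)
  fix d I J assume "tcontract 0 0 (tprod w T) d I J \<noteq> 0"
  then obtain k where "w d [] [k] * T d (k # I) J \<noteq> 0"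
    unfolding contract_covector_component[OF w] using sum.not_neutral_contains_not_neutral by blast
  then show "d \<in> charts_at \<A> x \<and> length I = p \<and> length J = q"
    using tensor_support[OF T, of d "k # I" J] by auto
next
  fix c d and I J :: "'n list"
  assume *: "c \<in> charts_at \<A> x" "d \<in> charts_at \<A> x" "length I = p" "length J = q"
  let ?C = "change_frame (jacobian c d x) (jacobian d c x)"
  have "T d (k # I) J = ?C (Suc p) q (T c) (k # I) J" for k
    using tensor_transform[OF T *(1,2) _ *(4)] *(3) by simp
  then have "tcontract 0 0 (tprod w T) d I J =
      (\<Sum>k\<in>UNIV. (\<Sum>m\<in>UNIV. jacobian c d x k m * ?C p q (\<lambda>K L. T c (m # K) L) I J) *
        (\<Sum>n\<in>UNIV. jacobian d c x n k * w c [] [n]))"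
    unfolding contract_covector_component[OF w] covector_transform[OF w *(1,2)]
    by (intro sum.cong refl) (simp add: change_frame_Cons_upper)
  also have "\<dots> = (\<Sum>m\<in>UNIV. ?C p q (\<lambda>K L. T c (m # K) L) I J * w c [] [m])"
    by (rule contraction_invariant[OF jacobian_inverse[OF *(1,2)]])
  finally show "tcontract 0 0 (tprod w T) d I J = ?C p q (tcontract 0 0 (tprod w T) c) I J"
    unfolding contract_covector_component[OF w] change_frame_sum by (simp add: mult.commute)
qed

lemma tscalar_in_tensors_at: "tscalar \<A> x a \<in> tensors_at \<A> x 0 0"
  by (rule tensors_atI) (auto simp: tscalar_def change_frame_0 split: if_splits)

lemma tensor_00_eq_tscalar:
  assumes "T \<in> tensors_at \<A> x 0 0" "c \<in> charts_at \<A> x"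
  shows "T = tscalar \<A> x (T c [] [])"
proof (intro ext)
  fix d I J
  show "T d I J = tscalar \<A> x (T c [] []) d I J"
    using tensor_support[OF assms(1), of d I J] tensor_transform[OF assms, of d "[]" "[]"]
    by (auto simp: tscalar_def change_frame_0)
qed

lemma pairing_eq_tscalar:
  assumes "v \<in> tensors_at \<A> x 1 0" "w \<in> tensors_at \<A> x 0 1" "c \<in> charts_at \<A> x"
  shows "tcontract 0 0 (tprod v w) = tscalar \<A> x (\<Sum>k\<in>UNIV. v c [k] [] * w c [] [k])"
  using tensor_00_eq_tscalar[OF contract_vector_in_tensors_at[OF assms(1)] assms(3), of w] assms(2)
  by (simp add: contract_vector_component[OF assms(1)])

text \<open>These are the basis \<open>\<partial>/\<partial>x\<^sup>k\<close> and the dual basis \<open>dx\<^sup>k\<close> of the chart \<open>c\<close>, given by their components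
in every chart \<open>d\<close> around \<open>x\<close>.\<close>

definition coord_vector :: "('m, 'n) chart \<Rightarrow> 'm \<Rightarrow> 'n \<Rightarrow> ('m, 'n) tensor" where
  "coord_vector c x k = (\<lambda>d I J.
     if d \<in> charts_at \<A> x \<and> length I = 1 \<and> J = [] then jacobian c d x (I ! 0) k else 0)"

definition coord_covector :: "('m, 'n) chart \<Rightarrow> 'm \<Rightarrow> 'n \<Rightarrow> ('m, 'n) tensor" where
  "coord_covector c x k = (\<lambda>d I J.
     if d \<in> charts_at \<A> x \<and> I = [] \<and> length J = 1 then jacobian d c x k (J ! 0) else 0)"

lemma coord_vector_in_tensors_at:
  assumes "c \<in> charts_at \<A> x"
  shows "coord_vector c x k \<in> tensors_at \<A> x 1 0"
  by (rule tensors_atI)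
     (auto simp: coord_vector_def length_Suc_conv change_frame_Cons_upper change_frame_0
        jacobian_chain[OF assms] split: if_splits)

lemma coord_covector_in_tensors_at:
  assumes "c \<in> charts_at \<A> x"
  shows "coord_covector c x k \<in> tensors_at \<A> x 0 1"
  by (rule tensors_atI)
     (auto simp: coord_covector_def length_Suc_conv change_frame_Cons_lower change_frame_0
        jacobian_chain_commuted[OF _ _ assms] split: if_splits)

lemma coord_vector_apply:
  "d \<in> charts_at \<A> x \<Longrightarrow> coord_vector c x k d [i] [] = jacobian c d x i k"
  by (simp add: coord_vector_def)

lemma coord_covector_apply:
  "d \<in> charts_at \<A> x \<Longrightarrow> coord_covector c x k d [] [j] = jacobian d c x k j"
  by (simp add: coord_covector_def)

lemma coord_vector_component:
  "c \<in> charts_at \<A> x \<Longrightarrow> coord_vector c x k c [i] [] = (if i = k then 1 else 0)"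
  by (simp add: coord_vector_def jacobian_self)

lemma coord_covector_component:
  "c \<in> charts_at \<A> x \<Longrightarrow> coord_covector c x k c [] [i] = (if i = k then 1 else 0)"
  by (auto simp: coord_covector_def jacobian_self)

text \<open>In a chart \<open>d\<close> the sum over \<open>k\<close> produces the product of the Jacobian from \<open>c\<close> to \<open>d\<close>
with its inverse, which is the identity; this is \<open>T = \<Sum>\<^sub>k \<partial>/\<partial>x\<^sup>k \<otimes> T(dx\<^sup>k, \<dots>)\<close>.\<close>

lemma expand_upper_index:
  assumes c: "c \<in> charts_at \<A> x" and T: "T \<in> tensors_at \<A> x (Suc p) q"
  shows "T = tlincomb (\<lambda>_. 1)
    (\<lambda>k. tprod (coord_vector c x k) (tcontract 0 0 (tprod (coord_covector c x k) T)))"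
proof (intro ext)
  fix d I J
  note e = coord_vector_in_tensors_at[OF c] and e' = coord_covector_in_tensors_at[OF c]
  show "T d I J = tlincomb (\<lambda>_. 1)
    (\<lambda>k. tprod (coord_vector c x k) (tcontract 0 0 (tprod (coord_covector c x k) T))) d I J"
  proof (cases I)
    case Nil
    then show ?thesis
      using tensor_support[OF T, of d I J] by (simp add: tlincomb_def tprod_vector_Nil[OF e])
  next
    case (Cons i I')
    show ?thesis
    proof (cases "d \<in> charts_at \<A> x")
      case True
      have "tlincomb (\<lambda>_. 1)
          (\<lambda>k. tprod (coord_vector c x k) (tcontract 0 0 (tprod (coord_covector c x k) T))) d I J
        = (\<Sum>k\<in>UNIV. \<Sum>m\<in>UNIV. jacobian c d x i k * jacobian d c x k m * T d (m # I') J)"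
        using True by (simp add: Cons tlincomb_def tprod_vector_Cons[OF e]
            contract_covector_component[OF e'] coord_vector_apply coord_covector_apply
            sum_distrib_left mult.assoc)
      also have "\<dots> = (\<Sum>m\<in>UNIV. (\<Sum>k\<in>UNIV. jacobian c d x i k * jacobian d c x k m) * T d (m # I') J)"
        by (subst sum.swap) (simp add: sum_distrib_right)
      also have "\<dots> = T d I J"
        by (simp add: jacobian_inverse[OF True c] Cons sum_Kronecker)
      finally show ?thesis ..
    next
      case False
      then show ?thesis
        using tensor_support[OF T, of d I J]
        by (simp add: Cons tlincomb_def tprod_vector_Cons[OF e] tensor_support[OF e])
    qed
  qed
qed

lemma expand_lower_index:
  assumes c: "c \<in> charts_at \<A> x" and T: "T \<in> tensors_at \<A> x p (Suc q)"
  shows "T = tlincomb (\<lambda>_. 1)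
    (\<lambda>k. tprod (coord_covector c x k) (tcontract 0 0 (tprod (coord_vector c x k) T)))"
proof (intro ext)
  fix d I J
  note e = coord_vector_in_tensors_at[OF c] and e' = coord_covector_in_tensors_at[OF c]
  show "T d I J = tlincomb (\<lambda>_. 1)
    (\<lambda>k. tprod (coord_covector c x k) (tcontract 0 0 (tprod (coord_vector c x k) T))) d I J"
  proof (cases J)
    case Nil
    then show ?thesis
      using tensor_support[OF T, of d I J] by (simp add: tlincomb_def tprod_covector_Nil[OF e'])
  next
    case (Cons j J')
    show ?thesis
    proof (cases "d \<in> charts_at \<A> x")
      case True
      have "tlincomb (\<lambda>_. 1)
          (\<lambda>k. tprod (coord_covector c x k) (tcontract 0 0 (tprod (coord_vector c x k) T))) d I J
        = (\<Sum>k\<in>UNIV. \<Sum>m\<in>UNIV. jacobian c d x m k * jacobian d c x k j * T d I (m # J'))"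
        using True by (simp add: Cons tlincomb_def tprod_covector_Cons[OF e']
            contract_vector_component[OF e] coord_vector_apply coord_covector_apply
            sum_distrib_left mult_ac)
      also have "\<dots> = (\<Sum>m\<in>UNIV. (\<Sum>k\<in>UNIV. jacobian c d x m k * jacobian d c x k j) * T d I (m # J'))"
        by (subst sum.swap) (simp add: sum_distrib_right)
      also have "\<dots> = T d I J"
        by (simp add: jacobian_inverse[OF True c] Cons sum_Kronecker)
      finally show ?thesis ..
    next
      case False
      then show ?thesis
        using tensor_support[OF T, of d I J]
        by (simp add: Cons tlincomb_def tprod_covector_Cons[OF e'] tensor_support[OF e'])
    qed
  qed
qed

end


section \<open>Flat linear transports in coordinates\<close>

lemma C1_on_cong:
  assumes "C1_on f S" "open S" "\<And>u. u \<in> S \<Longrightarrow> f u = g u"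
  shows "C1_on g S"
proof -
  obtain f' where f': "\<And>u. u \<in> S \<Longrightarrow> (f has_derivative blinfun_apply (f' u)) (at u)"
    "continuous_on S f'"
    using assms(1) unfolding C1_on_def by blast
  have "(g has_derivative blinfun_apply (f' u)) (at u)" if "u \<in> S" for u
    using has_derivative_transform_within_open[OF f'(1)[OF that] assms(2) that] assms(3) by blast
  with f'(2) show ?thesis
    unfolding C1_on_def by blast
qed

lemma C1_on_imp_differentiable: "C1_on f S \<Longrightarrow> u \<in> S \<Longrightarrow> f differentiable at u"
  unfolding C1_on_def differentiable_def by blast

lemma differentiable_cong_nhds:
  "\<forall>\<^sub>F u in nhds a. f u = g u \<Longrightarrow> f differentiable at a \<Longrightarrow> g differentiable at a"
  unfolding differentiable_def using has_derivative_cong_nhds by blast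

lemma differentiable_prod:
  fixes f :: "'i \<Rightarrow> 'a::real_normed_vector \<Rightarrow> real"
  assumes "\<And>i. i \<in> A \<Longrightarrow> f i differentiable at a"
  shows "(\<lambda>u. \<Prod>i\<in>A. f i u) differentiable at a"
  using assms by (induction A rule: infinite_finite_induct) (auto intro: differentiable_mult)

lemma change_frame_differentiable:
  assumes "\<And>i k. (\<lambda>u. a u i k) differentiable at z" "\<And>l j. (\<lambda>u. b u l j) differentiable at z"
    and "\<And>K L. length K = p \<Longrightarrow> length L = q \<Longrightarrow> (\<lambda>u. T u K L) differentiable at z"
  shows "(\<lambda>u. change_frame (a u) (b u) p q (T u) I J) differentiable at z"
  unfolding change_frame_def
  by (intro differentiable_sum differentiable_mult differentiable_prod ballI assms)
     (simp_all add: finite_lists_of_length)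

locale C1_flat_transport = C1_atlas X \<A>
  for X :: "'m topology" and \<A> :: "('m, 'n::finite) chart set" +
  fixes L :: "'m \<Rightarrow> 'm \<Rightarrow> ('m, 'n) tensor \<Rightarrow> ('m, 'n) tensor"
  assumes flat: "flat_linear_transport X \<A> L"
    and smooth: "C1_transport X \<A> L"
begin

lemmas flat_conj = flat[unfolded flat_linear_transport_def]

lemma L_in_tensors_at:
  "x \<in> topspace X \<Longrightarrow> y \<in> topspace X \<Longrightarrow> T \<in> tensors_at \<A> x p q \<Longrightarrow> L x y T \<in> tensors_at \<A> y p q"
  using flat_conj[THEN conjunct2, THEN conjunct1] by blast

lemma L_linear:
  "x \<in> topspace X \<Longrightarrow> y \<in> topspace X \<Longrightarrow> S \<in> tensors_at \<A> x p q \<Longrightarrow> T \<in> tensors_at \<A> x p q \<Longrightarrow>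
     L x y (tadd (tscale a S) (tscale b T)) = tadd (tscale a (L x y S)) (tscale b (L x y T))"
  using flat_conj[THEN conjunct2, THEN conjunct2, THEN conjunct1] by blast

lemma L_tprod:
  "x \<in> topspace X \<Longrightarrow> y \<in> topspace X \<Longrightarrow> S \<in> tensors_at \<A> x p q \<Longrightarrow> T \<in> tensors_at \<A> x p' q' \<Longrightarrow>
     L x y (tprod S T) = tprod (L x y S) (L x y T)"
  using flat_conj[THEN conjunct2, THEN conjunct2, THEN conjunct2, THEN conjunct1] by blast

lemma L_tcontract:
  "x \<in> topspace X \<Longrightarrow> y \<in> topspace X \<Longrightarrow> r < p \<Longrightarrow> s < q \<Longrightarrow> T \<in> tensors_at \<A> x p q \<Longrightarrow>
     L x y (tcontract r s T) = tcontract r s (L x y T)"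
  using flat_conj[THEN conjunct2, THEN conjunct2, THEN conjunct2, THEN conjunct2, THEN conjunct1] by blast

lemma L_trans:
  assumes "x \<in> topspace X" "y \<in> topspace X" "z \<in> topspace X" "T \<in> tensors_at \<A> x p q"
  shows "L y z (L x y T) = L x z T"
  using flat_conj[THEN conjunct2, THEN conjunct2, THEN conjunct2, THEN conjunct2, THEN conjunct2, THEN conjunct1] assms(1-3)
    tensors_at_subset_algebra[OF assms(4)] by blast

lemma L_refl:
  assumes "x \<in> topspace X" "T \<in> tensors_at \<A> x p q"
  shows "L x x T = T"
  using flat_conj[THEN conjunct2, THEN conjunct2, THEN conjunct2, THEN conjunct2, THEN conjunct2, THEN conjunct2] assms(1)
    tensors_at_subset_algebra[OF assms(2)] by blast

lemma L_tadd:
  assumes "x \<in> topspace X" "y \<in> topspace X" "S \<in> tensors_at \<A> x p q" "T \<in> tensors_at \<A> x p q"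
  shows "L x y (tadd S T) = tadd (L x y S) (L x y T)"
  using L_linear[OF assms, of 1 1] by (simp add: tscale_def)

lemma L_tscale:
  assumes "x \<in> topspace X" "y \<in> topspace X" "T \<in> tensors_at \<A> x p q"
  shows "L x y (tscale a T) = tscale a (L x y T)"
  using L_linear[OF assms(1,2,3,3), of a 0] by (simp add: tscale_def tadd_def)

lemma L_tzero:
  assumes "x \<in> topspace X" "y \<in> topspace X"
  shows "L x y tzero = tzero"
  using L_tscale[OF assms tzero_in_tensors_at, of 0] by (simp add: tscale_def tzero_def)

lemma L_sum:
  assumes xy: "x \<in> topspace X" "y \<in> topspace X"
    and "finite M" and T: "\<And>m. m \<in> M \<Longrightarrow> T m \<in> tensors_at \<A> x p q"
  shows "L x y (\<lambda>c I J. \<Sum>m\<in>M. f m * T m c I J) = (\<lambda>c I J. \<Sum>m\<in>M. f m * L x y (T m) c I J)"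
  using \<open>finite M\<close> T
proof (induction M rule: finite_induct)
  case empty
  then show ?case
    using L_tzero[OF xy] by (simp add: tzero_def)
next
  case (insert m M)
  let ?S = "\<lambda>c I J. \<Sum>m\<in>M. f m * T m c I J"
  have "?S \<in> tensors_at \<A> x p q"
    using insert.prems by (intro tensors_at_sum) auto
  then have "L x y (tadd (tscale (f m) (T m)) (tscale 1 ?S)) =
      tadd (tscale (f m) (L x y (T m))) (tscale 1 (L x y ?S))"
    using insert.prems by (intro L_linear[OF xy]) auto
  then show ?case
    using insert by (simp add: tadd_def tscale_def)
qed

lemma L_tlincomb:
  assumes "x \<in> topspace X" "y \<in> topspace X" "\<And>m. T m \<in> tensors_at \<A> x p q"
  shows "L x y (tlincomb f T) = tlincomb f (\<lambda>m. L x y (T m))"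
  unfolding tlincomb_def using assms by (intro L_sum) auto

text \<open>The unit scalar is idempotent for the tensor product, so its image is \<open>0\<close> or \<open>1\<close>; it is not \<open>0\<close>,
because transporting back must recover the unit.\<close>

lemma L_tscalar:
  assumes xy: "x \<in> topspace X" "y \<in> topspace X"
  shows "L x y (tscalar \<A> x a) = tscalar \<A> y a"
proof -
  obtain c d where c: "c \<in> charts_at \<A> x" and d: "d \<in> charts_at \<A> y"
    using charts_at_nonempty xy by blast
  define t where "t = L x y (tscalar \<A> x 1) d [] []"
  have 1: "tscalar \<A> x 1 \<in> tensors_at \<A> x 0 0"
    by (rule tscalar_in_tensors_at)
  have t: "L x y (tscalar \<A> x 1) = tscalar \<A> y t"
    unfolding t_def by (rule tensor_00_eq_tscalar[OF L_in_tensors_at[OF xy 1] d])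
  \<comment> \<open>Transporting \<open>1 \<otimes> 1 = 1\<close> gives \<open>t\<^sup>2 = t\<close>.\<close>
  have "tprod (tscalar \<A> x 1) (tscalar \<A> x 1) = tscalar \<A> x 1"
    by (intro ext) (simp add: tprod_scalar, simp add: tscalar_def)
  then have "tprod (tscalar \<A> y t) (tscalar \<A> y t) = tscalar \<A> y t"
    using L_tprod[OF xy 1 1] by (simp add: t)
  then have "tprod (tscalar \<A> y t) (tscalar \<A> y t) d [] [] = tscalar \<A> y t d [] []"
    by simp
  then have "t * t = t"
    using d by (simp add: tprod_scalar) (simp add: tscalar_def)
  moreover have "t \<noteq> 0"
  proof
    assume "t = 0"
    then have "L x y (tscalar \<A> x 1) = tzero"
      using t by (simp add: tscalar_def tzero_def)
    then have "tscalar \<A> x 1 = tzero"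
      using L_trans[OF xy xy(1) 1] L_refl[OF xy(1) 1] L_tzero[OF xy(2,1)] by simp
    then have "tscalar \<A> x 1 c [] [] = 0"
      by (simp add: tzero_def)
    then show False
      using c by (simp add: tscalar_def)
  qed
  ultimately have "t = 1" by simp
  have "tscalar \<A> z a = tscale a (tscalar \<A> z 1)" for z
    by (intro ext) (simp add: tscalar_def tscale_def)
  then show ?thesis
    using L_tscale[OF xy 1, of a] t \<open>t = 1\<close> by metis
qed

text \<open>The pairing is the contraction of a tensor product, both of which commute with \<open>L\<close>, and its value is
a scalar, on which \<open>L\<close> is the identity.\<close>

lemma L_pairing:
  assumes xy: "x \<in> topspace X" "y \<in> topspace X"
    and v: "v \<in> tensors_at \<A> x 1 0" and w: "w \<in> tensors_at \<A> x 0 1"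
    and c: "c \<in> charts_at \<A> x" and d: "d \<in> charts_at \<A> y"
  shows "(\<Sum>k\<in>UNIV. L x y v d [k] [] * L x y w d [] [k]) = (\<Sum>k\<in>UNIV. v c [k] [] * w c [] [k])"
    (is "?l = ?r")
proof -
  have "tprod v w \<in> tensors_at \<A> x 1 1"
    using tprod_vector_in_tensors_at[OF v w] by simp
  then have "L x y (tcontract 0 0 (tprod v w)) = tcontract 0 0 (tprod (L x y v) (L x y w))"
    using L_tcontract[OF xy, of 0 1 0 1] L_tprod[OF xy v w] by simp
  then have "tscalar \<A> y ?r = tscalar \<A> y ?l"
    using pairing_eq_tscalar[OF L_in_tensors_at[OF xy v] L_in_tensors_at[OF xy w] d]
    by (simp only: pairing_eq_tscalar[OF v w c] L_tscalar[OF xy])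
  then have "tscalar \<A> y ?r d [] [] = tscalar \<A> y ?l d [] []"
    by (rule arg_cong)
  then show ?thesis
    using d by (simp add: tscalar_def)
qed

text \<open>The matrix of the transport of covectors from \<open>y\<close> to \<open>x\<close> is that of the transport of vectors in the
opposite direction. Preservation of the pairing is applied to \<open>dx\<^sup>l\<close> and to the image
at \<open>y\<close> of a coordinate vector at \<open>x\<close>, which returns to that vector. Thus the inverse of the matrix of
\<open>L y x\<close>, which governs lower indices, is again a matrix of \<open>L\<close>.\<close>

lemma L_coord_covector:
  assumes c: "c \<in> charts_at \<A> y" and d: "d \<in> charts_at \<A> x"
  shows "L y x (coord_covector c y l) d [] [j] = L x y (coord_vector d x j) c [l] []"
proof -
  have xy: "x \<in> topspace X" "y \<in> topspace X"
    using c d charts_at_topspace by auto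
  note e = coord_vector_in_tensors_at[OF d]
  have "L y x (L x y (coord_vector d x j)) = coord_vector d x j"
    using L_trans[OF xy xy(1) e] L_refl[OF xy(1) e] by simp
  then show ?thesis
    using L_pairing[OF xy(2,1) L_in_tensors_at[OF xy e] coord_covector_in_tensors_at[OF c] c d, of j l]
    by (simp add: coord_vector_component[OF d] coord_covector_component[OF c] sum_Kronecker)
qed

text \<open>The expansion of \<open>T\<close> along its first index expresses \<open>L y x T\<close> by the images of the coordinate
covectors and of tensors with one index fewer.\<close>

lemma L_component_lower:
  assumes c: "c \<in> charts_at \<A> y" and x: "x \<in> topspace X"
    and "T \<in> tensors_at \<A> y 0 q" "length J = q" and d: "d \<in> charts_at \<A> x"
  shows "L y x T d [] J = change_frame (\<lambda>i k. L y x (coord_vector c y k) d [i] [])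
    (\<lambda>l j. L y x (coord_covector c y l) d [] [j]) 0 q (T c) [] J"
  using assms(3,4)
proof (induction q arbitrary: T J)
  case 0
  have y: "y \<in> topspace X"
    using c charts_at_topspace by auto
  show ?case
    using L_tscalar[OF y x, of "T c [] []", folded tensor_00_eq_tscalar[OF 0(1) c]] 0(2) d
    by (simp add: change_frame_0) (simp add: tscalar_def)
next
  case (Suc q)
  have y: "y \<in> topspace X"
    using c charts_at_topspace by auto
  obtain j J' where J: "J = j # J'" "length J' = q"
    using Suc.prems(2) by (auto simp: length_Suc_conv)
  let ?e = "coord_vector c y" and ?e' = "coord_covector c y"
  note e = coord_vector_in_tensors_at[OF c] and e' = coord_covector_in_tensors_at[OF c]
  let ?T = "\<lambda>l. tcontract 0 0 (tprod (?e l) T)"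
  have T: "?T l \<in> tensors_at \<A> y 0 q" for l
    by (rule contract_vector_in_tensors_at[OF e Suc.prems(1)])
  have Tc: "?T l c = (\<lambda>K L. T c K (l # L))" for l
    by (intro ext)
       (simp add: contract_vector_component[OF e] coord_vector_component[OF c] sum_Kronecker)
  have "L y x T = L y x (tlincomb (\<lambda>_. 1) (\<lambda>l. tprod (?e' l) (?T l)))"
    using expand_lower_index[OF c Suc.prems(1)] by simp
  also have "\<dots> = tlincomb (\<lambda>_. 1) (\<lambda>l. L y x (tprod (?e' l) (?T l)))"
    by (rule L_tlincomb[OF y x tprod_covector_in_tensors_at[OF e' T]])
  also have "\<dots> = tlincomb (\<lambda>_. 1) (\<lambda>l. tprod (L y x (?e' l)) (L y x (?T l)))"
    by (simp add: L_tprod[OF y x e' T])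
  finally have "L y x T d [] J = (\<Sum>l\<in>UNIV. L y x (?e' l) d [] [j] * L y x (?T l) d [] J')"
    by (simp add: tlincomb_def J tprod_covector_Cons[OF L_in_tensors_at[OF y x e']])
  then show ?case
    unfolding J change_frame_Cons_lower Suc.IH[OF T J(2)] Tc .
qed

text \<open>The same induction for the upper indices, with the purely covariant tensors as its base.\<close>

lemma L_component:
  assumes c: "c \<in> charts_at \<A> y" and x: "x \<in> topspace X"
    and "T \<in> tensors_at \<A> y p q" "length I = p" and J: "length J = q" and d: "d \<in> charts_at \<A> x"
  shows "L y x T d I J = change_frame (\<lambda>i k. L y x (coord_vector c y k) d [i] [])
    (\<lambda>l j. L y x (coord_covector c y l) d [] [j]) p q (T c) I J"
  using assms(3,4)
proof (induction p arbitrary: T I)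
  case 0
  then show ?case
    using L_component_lower[OF c x _ J d] by simp
next
  case (Suc p)
  have y: "y \<in> topspace X"
    using c charts_at_topspace by auto
  obtain i I' where I: "I = i # I'" "length I' = p"
    using Suc.prems(2) by (auto simp: length_Suc_conv)
  let ?e = "coord_vector c y" and ?e' = "coord_covector c y"
  note e = coord_vector_in_tensors_at[OF c] and e' = coord_covector_in_tensors_at[OF c]
  let ?T = "\<lambda>k. tcontract 0 0 (tprod (?e' k) T)"
  have T: "?T k \<in> tensors_at \<A> y p q" for k
    by (rule contract_covector_in_tensors_at[OF e' Suc.prems(1)])
  have Tc: "?T k c = (\<lambda>K. T c (k # K))" for k
    by (intro ext)
       (simp add: contract_covector_component[OF e'] coord_covector_component[OF c] sum_Kronecker)
  have "L y x T = L y x (tlincomb (\<lambda>_. 1) (\<lambda>k. tprod (?e k) (?T k)))"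
    using expand_upper_index[OF c Suc.prems(1)] by simp
  also have "\<dots> = tlincomb (\<lambda>_. 1) (\<lambda>k. L y x (tprod (?e k) (?T k)))"
    by (rule L_tlincomb[OF y x tprod_vector_in_tensors_at[OF e T]])
  also have "\<dots> = tlincomb (\<lambda>_. 1) (\<lambda>k. tprod (L y x (?e k)) (L y x (?T k)))"
    by (simp add: L_tprod[OF y x e T])
  finally have "L y x T d I J = (\<Sum>k\<in>UNIV. L y x (?e k) d [i] [] * L y x (?T k) d I' J)"
    by (simp add: tlincomb_def I tprod_vector_Cons[OF L_in_tensors_at[OF y x e]])
  then show ?case
    unfolding I change_frame_Cons_upper Suc.IH[OF T I(2)] Tc .
qed

text \<open>The coefficients of a vector in a frame are its pairings with the dual frame.\<close>

lemma frame_coefficient: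
  assumes E: "frame_field X \<A> E" and E': "dual_frame_field X \<A> E E'"
    and c: "c \<in> charts_at \<A> y"
  shows "coord_vector c y l = tlincomb (\<lambda>j. E' y j c [] [l]) (E y)"
proof -
  have y: "y \<in> topspace X"
    using c charts_at_topspace by auto
  have Ev: "E y i \<in> tensors_at \<A> y 1 0" for i
    using E y by (simp add: frame_field_def)
  have "(\<Sum>m\<in>UNIV. E y i c [m] [] * E' y j c [] [m]) = (if j = i then 1 else 0)" for i j
  proof -
    have "tcontract 0 0 (tprod (E y i) (E' y j)) c [] [] =
        tscalar \<A> y (if j = i then 1 else 0) c [] []"
      using E' y by (simp add: dual_frame_field_def)
    then show ?thesis
      using c by (simp add: contract_vector_component[OF Ev] tscalar_def)
  qed
  note dual = this
  obtain a where a: "coord_vector c y l = tlincomb a (E y)"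
    using E y coord_vector_in_tensors_at[OF c] unfolding frame_field_def by blast
  have "a j = E' y j c [] [l]" for j
  proof -
    have "E' y j c [] [l] = (\<Sum>m\<in>UNIV. coord_vector c y l c [m] [] * E' y j c [] [m])"
      by (simp add: coord_vector_component[OF c] sum_Kronecker)
    also have "\<dots> = (\<Sum>m\<in>UNIV. \<Sum>i\<in>UNIV. a i * (E y i c [m] [] * E' y j c [] [m]))"
      by (simp add: a tlincomb_def sum_distrib_right mult.assoc)
    also have "\<dots> = (\<Sum>i\<in>UNIV. a i * (\<Sum>m\<in>UNIV. E y i c [m] [] * E' y j c [] [m]))"
      by (subst sum.swap) (simp add: sum_distrib_left)
    finally show ?thesis
      by (simp add: dual sum_Kronecker)
  qed
  then show ?thesis
    using a by (metis ext)
qed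

text \<open>The components of the bivector are the matrix entries of \<open>L\<close> in coordinate bases: the given frames,
which may be discontinuous, cancel.\<close>

lemma L_coord_vector_C1:
  assumes c: "c \<in> \<A>" and d: "d \<in> \<A>"
  shows "C1_on (\<lambda>(u, v). L (chart_inv d v) (chart_inv c u) (coord_vector d (chart_inv d v) l) c [k] [])
    ((snd c ` fst c) \<times> (snd d ` fst d))"
proof -
  obtain E E' H where E: "frame_field X \<A> E" and E': "dual_frame_field X \<A> E E'"
    and H: "\<And>x y j. x \<in> topspace X \<Longrightarrow> y \<in> topspace X \<Longrightarrow>
        L x y (E x j) = tlincomb (\<lambda>i. H y x $ i $ j) (E y)"
    and C1: "C1_bivector \<A> E E' H"
    using smooth unfolding C1_transport_def by blast
  have "L y x (coord_vector d y l) c [k] [] =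
      (\<Sum>i\<in>UNIV. \<Sum>j\<in>UNIV. H x y $ i $ j * E x i c [k] [] * E' y j d [] [l])"
    if "x \<in> fst c" "y \<in> fst d" for x y
  proof -
    have xy: "x \<in> topspace X" "y \<in> topspace X"
      using that c d chart_in_topspace by auto
    have "d \<in> charts_at \<A> y"
      using that d by (simp add: charts_at_def)
    then have "L y x (coord_vector d y l) = L y x (tlincomb (\<lambda>j. E' y j d [] [l]) (E y))"
      by (simp add: frame_coefficient[OF E E'])
    also have "\<dots> = tlincomb (\<lambda>j. E' y j d [] [l]) (\<lambda>j. tlincomb (\<lambda>i. H x y $ i $ j) (E x))"
      using E xy H[OF xy(2,1)] by (subst L_tlincomb[OF xy(2,1)]) (auto simp: frame_field_def)
    finally have "L y x (coord_vector d y l) c [k] [] =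
        (\<Sum>j\<in>UNIV. \<Sum>i\<in>UNIV. H x y $ i $ j * E x i c [k] [] * E' y j d [] [l])"
      by (simp add: tlincomb_def sum_distrib_left mult_ac)
    then show ?thesis
      by (subst sum.swap)
  qed
  moreover have "C1_on (\<lambda>(u, v). \<Sum>i\<in>UNIV. \<Sum>j\<in>UNIV. H (chart_inv c u) (chart_inv d v) $ i $ j *
      E (chart_inv c u) i c [k] [] * E' (chart_inv d v) j d [] [l]) ((snd c ` fst c) \<times> (snd d ` fst d))"
    using C1 c d unfolding C1_bivector_def by blast
  ultimately show ?thesis
    by (elim C1_on_cong) (auto simp: open_Times open_chart c d chart_inv_coords)
qed

text \<open>Each statement restricts the function of two points from the previous lemma to one variable, keeping
the endpoint or the starting point of the transport at \<open>x\<close>.\<close>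

lemma L_coord_vector_differentiable:
  assumes c: "c \<in> charts_at \<A> x" and d: "d \<in> charts_at \<A> x"
  shows "(\<lambda>u. L (chart_inv c u) x (coord_vector c (chart_inv c u) l) d [k] []) differentiable at (snd c x)"
    (is ?A)
  and "(\<lambda>u. L x (chart_inv c u) (coord_vector d x l) c [k] []) differentiable at (snd c x)" (is ?B)
proof -
  let ?F = "\<lambda>c d. \<lambda>(u, v). L (chart_inv d v) (chart_inv c u) (coord_vector d (chart_inv d v) l) c [k] []"
  have x: "chart_inv c (snd c x) = x" "chart_inv d (snd d x) = x"
    using c d by (auto simp: charts_at_def chart_inv_coords)
  have F: "?F c' d' differentiable at (snd c' x, snd d' x)"
    if "c' \<in> charts_at \<A> x" "d' \<in> charts_at \<A> x" for c' d'
    using that C1_on_imp_differentiable[OF L_coord_vector_C1[of c' d' l k], of "(snd c' x, snd d' x)"]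
    by (auto simp: charts_at_def)
  have "(\<lambda>u. (snd d x, u)) differentiable at (snd c x)" "(\<lambda>u. (u, snd d x)) differentiable at (snd c x)"
    by (auto intro!: derivative_eq_intros simp: differentiable_def)
  from differentiable_chain_at[OF this(1)] differentiable_chain_at[OF this(2)] F[OF d c] F[OF c d]
  have "(?F d c \<circ> (\<lambda>u. (snd d x, u))) differentiable at (snd c x)"
    "(?F c d \<circ> (\<lambda>u. (u, snd d x))) differentiable at (snd c x)"
    by blast+
  then show ?A ?B
    by (simp_all add: o_def x)
qed

text \<open>Near \<open>x\<close> each component is a polynomial in the matrix entries of \<open>L\<close> and the components of \<open>S\<close>.\<close>

lemma pullback_differentiable:
  assumes S: "C1_tensor_field X \<A> p q S" and c: "c \<in> charts_at \<A> x"
  shows "(\<lambda>u. L (chart_inv c u) x (S (chart_inv c u)) d I J) differentiable at (snd c x)"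
proof -
  have x: "x \<in> topspace X"
    using c charts_at_topspace by auto
  have ev: "\<forall>\<^sub>F u in nhds (snd c x). chart_inv c u \<in> fst c"
    using eventually_in_chart[OF c c] by (auto elim: eventually_mono)
  have y: "y \<in> topspace X" if "y \<in> fst c" for y
    using chart_in_topspace[OF charts_atD(1)[OF c] that] .
  have cy: "c \<in> charts_at \<A> y" if "y \<in> fst c" for y
    using that c by (simp add: charts_at_def)
  have Sy: "S y \<in> tensors_at \<A> y p q" if "y \<in> fst c" for y
    using S y[OF that] by (simp add: C1_tensor_field_def tensor_field_def)
  show ?thesis
  proof (cases "d \<in> charts_at \<A> x \<and> length I = p \<and> length J = q")
    case False
    have "\<forall>\<^sub>F u in nhds (snd c x). 0 = L (chart_inv c u) x (S (chart_inv c u)) d I J"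
      using ev
    proof eventually_elim
      case (elim u)
      show ?case
        using tensor_support[OF L_in_tensors_at[OF y[OF elim] x Sy[OF elim]] False] by simp
    qed
    then show ?thesis
      by (rule differentiable_cong_nhds) simp
  next
    case True
    then have d: "d \<in> charts_at \<A> x" and IJ: "length I = p" "length J = q" by auto
    have "(\<lambda>u. S (chart_inv c u) c K M) differentiable at (snd c x)"
      if "length K = p" "length M = q" for K M
      using S c that by (intro C1_on_imp_differentiable) (auto simp: C1_tensor_field_def charts_at_def)
    then have "(\<lambda>u. change_frame (\<lambda>i k. L (chart_inv c u) x (coord_vector c (chart_inv c u) k) d [i] [])
        (\<lambda>l j. L x (chart_inv c u) (coord_vector d x j) c [l] []) p q (S (chart_inv c u) c) I J)
      differentiable at (snd c x)"
      by (intro change_frame_differentiable L_coord_vector_differentiable[OF c d])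
    moreover have "\<forall>\<^sub>F u in nhds (snd c x).
        change_frame (\<lambda>i k. L (chart_inv c u) x (coord_vector c (chart_inv c u) k) d [i] [])
          (\<lambda>l j. L x (chart_inv c u) (coord_vector d x j) c [l] []) p q (S (chart_inv c u) c) I J =
        L (chart_inv c u) x (S (chart_inv c u)) d I J"
      using ev
    proof eventually_elim
      case (elim u)
      show ?case
        using L_component[OF cy[OF elim] x Sy[OF elim] IJ d]
        by (simp add: L_coord_covector[OF cy[OF elim] d])
    qed
    ultimately show ?thesis
      by (rule differentiable_cong_nhds[rotated])
  qed
qed


section \<open>The derivative along a vector field\<close>

lemma vector_fieldD: "tensor_field X \<A> 1 0 V \<Longrightarrow> x \<in> topspace X \<Longrightarrow> V x \<in> tensors_at \<A> x 1 0"
  by (simp add: tensor_field_def)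

lemma displaced_0: "c \<in> charts_at \<A> x \<Longrightarrow> displaced c V x 0 = x"
  by (simp add: displaced_def charts_at_def chart_inv_coords)

lemma eventually_displaced:
  assumes "c \<in> charts_at \<A> x"
  shows "\<forall>\<^sub>F \<epsilon> in nhds 0. displaced c V x \<epsilon> \<in> topspace X"
proof -
  have "((\<lambda>\<epsilon>. snd c x + \<epsilon> *\<^sub>R vector_components (V x) c) \<longlongrightarrow>
      snd c x + 0 *\<^sub>R vector_components (V x) c) (nhds 0)"
    by (intro tendsto_intros filterlim_ident)
  then have "filterlim (\<lambda>\<epsilon>. snd c x + \<epsilon> *\<^sub>R vector_components (V x) c) (nhds (snd c x)) (nhds 0)"
    by simp
  from eventually_compose_filterlim[OF eventually_in_chart[OF assms assms] this]
  show ?thesis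
    using chart_in_topspace[OF charts_atD(1)[OF assms]]
    by (auto elim!: eventually_mono simp: displaced_def)
qed

text \<open>At \<open>\<epsilon> = 0\<close> the transported field has the value \<open>S x\<close>, so the limit in the definition of the connection is
a derivative of a real function, and the rules of differentiation apply.\<close>

lemma has_transport_derivative_iff:
  assumes "c \<in> charts_at \<A> x" "L x x (S x) = S x"
  shows "has_transport_derivative L c V S x T \<longleftrightarrow>
    (\<forall>d I J. ((\<lambda>\<epsilon>. L (displaced c V x \<epsilon>) x (S (displaced c V x \<epsilon>)) d I J)
       has_real_derivative T d I J) (at 0))"
  using assms by (simp add: has_transport_derivative_def DERIV_def displaced_0)

text \<open>The differential at \<open>x\<close>, in the coordinates of \<open>c\<close>, of the field transported to \<open>x\<close>, applied to \<open>V x\<close>.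
In this form the dependence on \<open>V\<close> is visibly linear.\<close>

definition pullback_derivative where
  "pullback_derivative c V S x = (\<lambda>d I J.
     frechet_derivative (\<lambda>u. L (chart_inv c u) x (S (chart_inv c u)) d I J) (at (snd c x))
       (vector_components (V x) c))"

lemma pullback_derivative_works:
  assumes "C1_tensor_field X \<A> p q S" "c \<in> charts_at \<A> x"
  shows "((\<lambda>u. L (chart_inv c u) x (S (chart_inv c u)) d I J) has_derivative
    frechet_derivative (\<lambda>u. L (chart_inv c u) x (S (chart_inv c u)) d I J) (at (snd c x))) (at (snd c x))"
  using pullback_differentiable[OF assms] by (simp add: frechet_derivative_works)

lemma C1_tensor_field_L_refl:
  "C1_tensor_field X \<A> p q S \<Longrightarrow> x \<in> topspace X \<Longrightarrow> L x x (S x) = S x"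
  by (auto simp: C1_tensor_field_def tensor_field_def intro: L_refl)

lemma has_transport_derivative_pullback:
  assumes S: "C1_tensor_field X \<A> p q S" and c: "c \<in> charts_at \<A> x"
  shows "has_transport_derivative L c V S x (pullback_derivative c V S x)"
proof -
  let ?v = "vector_components (V x) c"
  have line: "((\<lambda>\<epsilon>. snd c x + \<epsilon> *\<^sub>R ?v) has_derivative (\<lambda>\<epsilon>. \<epsilon> *\<^sub>R ?v)) (at 0)"
    by (auto intro!: derivative_eq_intros)
  have "((\<lambda>\<epsilon>. L (displaced c V x \<epsilon>) x (S (displaced c V x \<epsilon>)) d I J)
      has_real_derivative pullback_derivative c V S x d I J) (at 0)" for d I J
  proof -
    let ?g = "\<lambda>u. L (chart_inv c u) x (S (chart_inv c u)) d I J"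
    let ?D = "frechet_derivative ?g (at (snd c x))"
    have g: "(?g has_derivative ?D) (at (snd c x + 0 *\<^sub>R ?v))"
      using pullback_derivative_works[OF S c] by simp
    have "?D (\<epsilon> *\<^sub>R ?v) = ?D ?v * \<epsilon>" for \<epsilon>
      using linear_scale[OF has_derivative_linear[OF g]] by simp
    then have "?D \<circ> (\<lambda>\<epsilon>. \<epsilon> *\<^sub>R ?v) = (*) (?D ?v)"
      by (simp add: fun_eq_iff)
    then show ?thesis
      using diff_chain_at[OF line g]
      by (simp add: has_field_derivative_def pullback_derivative_def displaced_def o_def)
  qed
  then show ?thesis
    by (simp add: has_transport_derivative_iff[of c x S, OF c]
        C1_tensor_field_L_refl[OF S charts_at_topspace[OF c]])
qed

text \<open>The fields read in \<open>c\<close> and in \<open>d\<close> differ by the coordinate change, whose differential takes the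
components of \<open>V x\<close> in \<open>d\<close> to those in \<open>c\<close>.\<close>

lemma pullback_derivative_chart_independent:
  assumes S: "C1_tensor_field X \<A> p q S" and V: "tensor_field X \<A> 1 0 V"
    and c: "c \<in> charts_at \<A> x" and d: "d \<in> charts_at \<A> x"
  shows "pullback_derivative d V S x = pullback_derivative c V S x"
proof (intro ext)
  fix e I J
  let ?g = "\<lambda>c u. L (chart_inv c u) x (S (chart_inv c u)) e I J"
  let ?D = "\<lambda>c. frechet_derivative (?g c) (at (snd c x))"
  let ?M = "\<lambda>h. \<chi> i. \<Sum>k\<in>UNIV. jacobian d c x i k * h $ k"
  have "snd c x = (snd c \<circ> chart_inv d) (snd d x)"
    using d by (simp add: charts_at_def chart_inv_coords)
  then have "(?g c has_derivative ?D c) (at ((snd c \<circ> chart_inv d) (snd d x)))"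
    using pullback_derivative_works[OF S c] by simp
  from diff_chain_at[OF transition_has_derivative[OF d c] this]
  have "((?g c \<circ> (snd c \<circ> chart_inv d)) has_derivative ?D c \<circ> ?M) (at (snd d x))" .
  moreover have "\<forall>\<^sub>F u in nhds (snd d x). (?g c \<circ> (snd c \<circ> chart_inv d)) u = ?g d u"
    using eventually_in_chart[OF d c] c
    by (auto elim!: eventually_mono simp: charts_at_def chart_inv_coords)
  ultimately have "(?g d has_derivative ?D c \<circ> ?M) (at (snd d x))"
    by (rule has_derivative_cong_nhds[rotated])
  from has_derivative_unique[OF pullback_derivative_works[OF S d] this]
  have "?D d (vector_components (V x) d) = ?D c (?M (vector_components (V x) d))"
    by simp
  also have "?M (vector_components (V x) d) = vector_components (V x) c"
    by (simp add: vector_components_def vector_transform[OF vector_fieldD[OF V charts_at_topspace[OF c]] d c, symmetric])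
  finally show "pullback_derivative d V S x e I J = pullback_derivative c V S x e I J"
    by (simp add: pullback_derivative_def)
qed

text \<open>The definition of \<^const>\<open>nabla\<close> only asks for some chart, so a tensor is the described one as
soon as it is the limit in every chart.\<close>

lemma nabla_eqI:
  assumes x: "x \<in> topspace X"
    and T: "\<And>c. c \<in> charts_at \<A> x \<Longrightarrow> has_transport_derivative L c V S x T"
  shows "nabla \<A> L V S x = T"
  unfolding nabla_def
proof (rule the_equality)
  show "\<exists>c\<in>charts_at \<A> x. has_transport_derivative L c V S x T"
    using charts_at_nonempty[OF x] T by blast
next
  fix T' assume "\<exists>c\<in>charts_at \<A> x. has_transport_derivative L c V S x T'"
  then obtain c where c: "c \<in> charts_at \<A> x" "has_transport_derivative L c V S x T'"
    by blast
  have "T' d I J = T d I J" for d I J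
    using c(2) T[OF c(1)] unfolding has_transport_derivative_def by (blast intro: LIM_unique)
  then show "T' = T" by (intro ext)
qed

lemma nabla_eq:
  assumes S: "C1_tensor_field X \<A> p q S" and V: "tensor_field X \<A> 1 0 V"
    and c: "c \<in> charts_at \<A> x"
  shows "nabla \<A> L V S x = pullback_derivative c V S x"
proof (rule nabla_eqI)
  show "x \<in> topspace X"
    using c by (rule charts_at_topspace)
  fix d assume d: "d \<in> charts_at \<A> x"
  show "has_transport_derivative L d V S x (pullback_derivative c V S x)"
    using has_transport_derivative_pullback[OF S d, of V]
    by (simp add: pullback_derivative_chart_independent[where c = c and d = d, OF S V c d])
qed

lemma has_transport_derivative_nabla:
  assumes "C1_tensor_field X \<A> p q S" "tensor_field X \<A> 1 0 V" "c \<in> charts_at \<A> x"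
  shows "has_transport_derivative L c V S x (nabla \<A> L V S x)"
  using has_transport_derivative_pullback[OF assms(1,3)] nabla_eq[OF assms] by simp

lemma nabla_has_real_derivative:
  assumes "C1_tensor_field X \<A> p q S" "tensor_field X \<A> 1 0 V" "c \<in> charts_at \<A> x"
  shows "((\<lambda>\<epsilon>. L (displaced c V x \<epsilon>) x (S (displaced c V x \<epsilon>)) d I J)
    has_real_derivative nabla \<A> L V S x d I J) (at 0)"
  using has_transport_derivative_nabla[OF assms]
  by (simp add: has_transport_derivative_iff[of c x S, OF assms(3)]
      C1_tensor_field_L_refl[OF assms(1) charts_at_topspace[OF assms(3)]] del: split_paired_All)


section \<open>The axioms of a linear connection\<close>

lemma C1_tensor_fieldD:
  "C1_tensor_field X \<A> p q S \<Longrightarrow> y \<in> topspace X \<Longrightarrow> S y \<in> tensors_at \<A> y p q"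
  by (simp add: C1_tensor_field_def tensor_field_def)

text \<open>The difference quotients are tensors at \<open>x\<close> for all small \<open>\<epsilon>\<close>, and limits of tensors are tensors.\<close>

lemma nabla_in_tensors_at:
  assumes S: "C1_tensor_field X \<A> p q S" and V: "tensor_field X \<A> 1 0 V" and x: "x \<in> topspace X"
  shows "nabla \<A> L V S x \<in> tensors_at \<A> x p q"
proof -
  obtain c where c: "c \<in> charts_at \<A> x"
    using charts_at_nonempty[OF x] by blast
  let ?y = "displaced c V x"
  let ?Q = "\<lambda>\<epsilon>. tscale (1 / \<epsilon>) (tadd (L (?y \<epsilon>) x (S (?y \<epsilon>))) (tscale (- 1) (S x)))"
  show ?thesis
  proof (rule tensors_at_limit)
    show "at (0 :: real) \<noteq> bot" by simp
    have "\<forall>\<^sub>F \<epsilon> in at 0. ?y \<epsilon> \<in> topspace X"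
      using eventually_displaced[OF c] by (simp add: eventually_nhds_conv_at)
    then show "\<forall>\<^sub>F \<epsilon> in at 0. ?Q \<epsilon> \<in> tensors_at \<A> x p q"
      by eventually_elim (intro tscale_in_tensors_at tadd_in_tensors_at L_in_tensors_at
          C1_tensor_fieldD[OF S] x)
    show "((\<lambda>\<epsilon>. ?Q \<epsilon> d I J) \<longlongrightarrow> nabla \<A> L V S x d I J) (at 0)" for d I J
      using has_transport_derivative_nabla[OF S V c]
      by (simp add: has_transport_derivative_def tscale_def tadd_def del: split_paired_All)
  qed
qed

lemma nabla_tcontract:
  assumes S: "C1_tensor_field X \<A> p q S" and V: "tensor_field X \<A> 1 0 V" and x: "x \<in> topspace X"
    and rs: "r < p" "s < q"
  shows "nabla \<A> L V (\<lambda>y. tcontract r s (S y)) x = tcontract r s (nabla \<A> L V S x)"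
proof (rule nabla_eqI[OF x])
  fix c assume c: "c \<in> charts_at \<A> x"
  let ?y = "displaced c V x"
  have L: "L y x (tcontract r s (S y)) = tcontract r s (L y x (S y))" if "y \<in> topspace X" for y
    using L_tcontract[OF that x rs C1_tensor_fieldD[OF S that]] .
  have "((\<lambda>\<epsilon>. tcontract r s (L (?y \<epsilon>) x (S (?y \<epsilon>))) d I J)
      has_real_derivative tcontract r s (nabla \<A> L V S x) d I J) (at 0)" for d I J
    unfolding tcontract_def by (intro DERIV_sum nabla_has_real_derivative[OF S V c])
  moreover have "\<forall>\<^sub>F \<epsilon> in nhds 0. tcontract r s (L (?y \<epsilon>) x (S (?y \<epsilon>))) d I J =
      L (?y \<epsilon>) x (tcontract r s (S (?y \<epsilon>))) d I J" for d I J
    using eventually_displaced[OF c, of V] by eventually_elim (simp add: L)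
  ultimately have "((\<lambda>\<epsilon>. L (?y \<epsilon>) x (tcontract r s (S (?y \<epsilon>))) d I J)
      has_real_derivative tcontract r s (nabla \<A> L V S x) d I J) (at 0)" for d I J
    by (rule has_real_derivative_cong_nhds[rotated])
  then show "has_transport_derivative L c V (\<lambda>y. tcontract r s (S y)) x
      (tcontract r s (nabla \<A> L V S x))"
    using has_transport_derivative_iff[OF c, of "\<lambda>y. tcontract r s (S y)"]
    by (simp add: L x C1_tensor_field_L_refl[OF S])
qed

lemma nabla_tadd:
  assumes S: "C1_tensor_field X \<A> p q S" and T: "C1_tensor_field X \<A> p q T"
    and V: "tensor_field X \<A> 1 0 V" and x: "x \<in> topspace X"
  shows "nabla \<A> L V (\<lambda>y. tadd (S y) (T y)) x = tadd (nabla \<A> L V S x) (nabla \<A> L V T x)"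
proof (rule nabla_eqI[OF x])
  fix c assume c: "c \<in> charts_at \<A> x"
  let ?y = "displaced c V x"
  have L: "L y x (tadd (S y) (T y)) = tadd (L y x (S y)) (L y x (T y))" if "y \<in> topspace X" for y
    using L_tadd[OF that x C1_tensor_fieldD[OF S that] C1_tensor_fieldD[OF T that]] .
  have "((\<lambda>\<epsilon>. tadd (L (?y \<epsilon>) x (S (?y \<epsilon>))) (L (?y \<epsilon>) x (T (?y \<epsilon>))) d I J)
      has_real_derivative tadd (nabla \<A> L V S x) (nabla \<A> L V T x) d I J) (at 0)" for d I J
    unfolding tadd_def
    by (intro DERIV_add nabla_has_real_derivative[OF S V c] nabla_has_real_derivative[OF T V c])
  moreover have "\<forall>\<^sub>F \<epsilon> in nhds 0. tadd (L (?y \<epsilon>) x (S (?y \<epsilon>))) (L (?y \<epsilon>) x (T (?y \<epsilon>))) d I J =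
      L (?y \<epsilon>) x (tadd (S (?y \<epsilon>)) (T (?y \<epsilon>))) d I J" for d I J
    using eventually_displaced[OF c, of V] by eventually_elim (simp add: L)
  ultimately have "((\<lambda>\<epsilon>. L (?y \<epsilon>) x (tadd (S (?y \<epsilon>)) (T (?y \<epsilon>))) d I J)
      has_real_derivative tadd (nabla \<A> L V S x) (nabla \<A> L V T x) d I J) (at 0)" for d I J
    by (rule has_real_derivative_cong_nhds[rotated])
  then show "has_transport_derivative L c V (\<lambda>y. tadd (S y) (T y)) x
      (tadd (nabla \<A> L V S x) (nabla \<A> L V T x))"
    using has_transport_derivative_iff[OF c, of "\<lambda>y. tadd (S y) (T y)"]
    by (simp add: L x C1_tensor_field_L_refl[OF S] C1_tensor_field_L_refl[OF T])
qed

lemma tprod_has_real_derivative: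
  assumes A: "\<And>d I J. ((\<lambda>\<epsilon>. A \<epsilon> d I J) has_real_derivative A' d I J) (at a)"
    and B: "\<And>d I J. ((\<lambda>\<epsilon>. B \<epsilon> d I J) has_real_derivative B' d I J) (at a)"
  shows "((\<lambda>\<epsilon>. tprod (A \<epsilon>) (B \<epsilon>) d I J) has_real_derivative
    tadd (tprod A' (B a)) (tprod (A a) B') d I J) (at a)"
proof -
  have "((\<lambda>\<epsilon>. \<Sum>k\<le>length I. \<Sum>l\<le>length J. A \<epsilon> d (take k I) (take l J) * B \<epsilon> d (drop k I) (drop l J))
    has_real_derivative (\<Sum>k\<le>length I. \<Sum>l\<le>length J.
      A' d (take k I) (take l J) * B a d (drop k I) (drop l J) +
      B' d (drop k I) (drop l J) * A a d (take k I) (take l J))) (at a)"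
    by (intro DERIV_sum DERIV_mult A B)
  then show ?thesis
    by (simp add: tprod_def tadd_def sum.distrib mult.commute)
qed

lemma nabla_tprod:
  assumes S: "C1_tensor_field X \<A> p q S" and T: "C1_tensor_field X \<A> p' q' T"
    and V: "tensor_field X \<A> 1 0 V" and x: "x \<in> topspace X"
  shows "nabla \<A> L V (\<lambda>y. tprod (S y) (T y)) x =
    tadd (tprod (nabla \<A> L V S x) (T x)) (tprod (S x) (nabla \<A> L V T x))" (is "_ = ?R")
proof (rule nabla_eqI[OF x])
  fix c assume c: "c \<in> charts_at \<A> x"
  let ?y = "displaced c V x"
  have L: "L y x (tprod (S y) (T y)) = tprod (L y x (S y)) (L y x (T y))" if "y \<in> topspace X" for y
    using L_tprod[OF that x C1_tensor_fieldD[OF S that] C1_tensor_fieldD[OF T that]] .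
  have "((\<lambda>\<epsilon>. tprod (L (?y \<epsilon>) x (S (?y \<epsilon>))) (L (?y \<epsilon>) x (T (?y \<epsilon>))) d I J)
      has_real_derivative ?R d I J) (at 0)" for d I J
    using tprod_has_real_derivative[OF nabla_has_real_derivative[OF S V c]
        nabla_has_real_derivative[OF T V c],
        where d = d and I = I and J = J]
    by (simp add: displaced_0[OF c] C1_tensor_field_L_refl[OF S x] C1_tensor_field_L_refl[OF T x])
  moreover have "\<forall>\<^sub>F \<epsilon> in nhds 0. tprod (L (?y \<epsilon>) x (S (?y \<epsilon>))) (L (?y \<epsilon>) x (T (?y \<epsilon>))) d I J =
      L (?y \<epsilon>) x (tprod (S (?y \<epsilon>)) (T (?y \<epsilon>))) d I J" for d I J
    using eventually_displaced[OF c, of V] by eventually_elim (simp add: L)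
  ultimately have "((\<lambda>\<epsilon>. L (?y \<epsilon>) x (tprod (S (?y \<epsilon>)) (T (?y \<epsilon>))) d I J)
      has_real_derivative ?R d I J) (at 0)" for d I J
    by (rule has_real_derivative_cong_nhds[rotated])
  then show "has_transport_derivative L c V (\<lambda>y. tprod (S y) (T y)) x ?R"
    using has_transport_derivative_iff[OF c, of "\<lambda>y. tprod (S y) (T y)"]
    by (simp add: L x C1_tensor_field_L_refl[OF S] C1_tensor_field_L_refl[OF T])
qed

lemma C1_tensor_field_tscalar:
  assumes "C1_function \<A> f"
  shows "C1_tensor_field X \<A> 0 0 (\<lambda>y. tscalar \<A> y (f y))"
proof -
  have "C1_on (\<lambda>u. tscalar \<A> (chart_inv c u) (f (chart_inv c u)) c [] []) (snd c ` fst c)"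
    if c: "c \<in> \<A>" for c
  proof (rule C1_on_cong)
    show "C1_on (f \<circ> chart_inv c) (snd c ` fst c)"
      using assms c by (simp add: C1_function_def)
    show "open (snd c ` fst c)"
      by (rule open_chart[OF c])
    show "(f \<circ> chart_inv c) u = tscalar \<A> (chart_inv c u) (f (chart_inv c u)) c [] []"
      if "u \<in> snd c ` fst c" for u
      using c chart_inv_in[OF that c] by (simp add: tscalar_def charts_at_def)
  qed
  then show ?thesis
    by (auto simp: C1_tensor_field_def tensor_field_def tscalar_in_tensors_at)
qed

text \<open>The transport of a scalar field to \<open>x\<close> is the function itself. The chart on the right-hand side is
arbitrary, as \<open>\<nabla>\<close> can be computed in any of them.\<close>

lemma nabla_tscalar:
  assumes f: "C1_function \<A> f" and V: "tensor_field X \<A> 1 0 V" and c: "c \<in> charts_at \<A> x"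
  shows "nabla \<A> L V (\<lambda>y. tscalar \<A> y (f y)) x = tscalar \<A> x (vf_deriv c V f x)"
proof (intro ext)
  fix d I J
  have x: "x \<in> topspace X"
    by (rule charts_at_topspace[OF c])
  let ?g = "\<lambda>u. L (chart_inv c u) x (tscalar \<A> (chart_inv c u) (f (chart_inv c u))) d I J"
  let ?h = "\<lambda>u. tscalar \<A> x ((f \<circ> chart_inv c) u) d I J"
  let ?D = "frechet_derivative (f \<circ> chart_inv c) (at (snd c x))"
  have "(f \<circ> chart_inv c) differentiable at (snd c x)"
    using f c by (intro C1_on_imp_differentiable) (auto simp: C1_function_def charts_at_def)
  then have "((f \<circ> chart_inv c) has_derivative ?D) (at (snd c x))"
    by (simp add: frechet_derivative_works)
  then have "(?h has_derivative (\<lambda>v. tscalar \<A> x (?D v) d I J)) (at (snd c x))"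
    by (cases "d \<in> charts_at \<A> x \<and> I = [] \<and> J = []") (auto simp: tscalar_def o_def)
  moreover have "\<forall>\<^sub>F u in nhds (snd c x). ?h u = ?g u"
    using eventually_in_chart[OF c c]
  proof eventually_elim
    case (elim u)
    then have "chart_inv c u \<in> topspace X"
      using chart_in_topspace[OF charts_atD(1)[OF c]] by blast
    then show ?case
      by (simp add: L_tscalar[OF _ x])
  qed
  ultimately have "(?g has_derivative (\<lambda>v. tscalar \<A> x (?D v) d I J)) (at (snd c x))"
    by (rule has_derivative_cong_nhds[rotated])
  then have "frechet_derivative ?g (at (snd c x)) = (\<lambda>v. tscalar \<A> x (?D v) d I J)"
    by (rule frechet_derivative_at[symmetric])
  then show "nabla \<A> L V (\<lambda>y. tscalar \<A> y (f y)) x d I J = tscalar \<A> x (vf_deriv c V f x) d I J"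
    by (simp add: nabla_eq[OF C1_tensor_field_tscalar[OF f] V c] pullback_derivative_def vf_deriv_def)
qed

lemma nabla_tadd_direction:
  assumes S: "C1_tensor_field X \<A> p q S" and x: "x \<in> topspace X"
    and V: "tensor_field X \<A> 1 0 V" and W: "tensor_field X \<A> 1 0 W"
  shows "nabla \<A> L (\<lambda>y. tadd (V y) (W y)) S x = tadd (nabla \<A> L V S x) (nabla \<A> L W S x)"
proof -
  obtain c where c: "c \<in> charts_at \<A> x"
    using charts_at_nonempty[OF x] by blast
  have "vector_components (tadd (V x) (W x)) c = vector_components (V x) c + vector_components (W x) c"
    by (simp add: vector_components_def tadd_def vec_eq_iff)
  moreover have "tensor_field X \<A> 1 0 (\<lambda>y. tadd (V y) (W y))"
    using V W by (simp add: tensor_field_def tadd_in_tensors_at)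
  ultimately have "nabla \<A> L (\<lambda>y. tadd (V y) (W y)) S x d I J =
      nabla \<A> L V S x d I J + nabla \<A> L W S x d I J" for d I J
    using linear_add[OF has_derivative_linear[OF pullback_derivative_works[OF S c]]] V W
    by (simp add: nabla_eq[OF S _ c] pullback_derivative_def)
  then show ?thesis
    by (intro ext) (simp add: tadd_def[of "nabla \<A> L V S x"])
qed

lemma nabla_tscale_direction:
  assumes S: "C1_tensor_field X \<A> p q S" and x: "x \<in> topspace X" and V: "tensor_field X \<A> 1 0 V"
  shows "nabla \<A> L (\<lambda>y. tscale (f y) (V y)) S x = tscale (f x) (nabla \<A> L V S x)"
proof -
  obtain c where c: "c \<in> charts_at \<A> x"
    using charts_at_nonempty[OF x] by blast
  have "vector_components (tscale (f x) (V x)) c = f x *\<^sub>R vector_components (V x) c"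
    by (simp add: vector_components_def tscale_def vec_eq_iff)
  moreover have "tensor_field X \<A> 1 0 (\<lambda>y. tscale (f y) (V y))"
    using V by (simp add: tensor_field_def tscale_in_tensors_at)
  ultimately have "nabla \<A> L (\<lambda>y. tscale (f y) (V y)) S x d I J = f x * nabla \<A> L V S x d I J"
    for d I J
    using linear_scale[OF has_derivative_linear[OF pullback_derivative_works[OF S c]]] V
    by (simp add: nabla_eq[OF S _ c] pullback_derivative_def)
  then show ?thesis
    by (intro ext) (simp add: tscale_def[of _ "nabla \<A> L V S x"])
qed

lemma linear_connection_nabla: "linear_connection X \<A> (nabla \<A> L)"
  unfolding linear_connection_def
proof (intro conjI allI impI ballI)
  fix V p q S
  assume "tensor_field X \<A> 1 0 V" "C1_tensor_field X \<A> p q S"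
  then show "tensor_field X \<A> p q (nabla \<A> L V S)"
    unfolding tensor_field_def[of _ _ p q] using nabla_in_tensors_at by blast
qed (rule nabla_tcontract nabla_tprod nabla_tadd nabla_tscalar nabla_tadd_direction
    nabla_tscale_direction; assumption)+

end

theorem proposition3p1:
  fixes X :: "'m topology"
    and \<A> :: "('m, 'n::finite) chart set"
    and L :: "'m \<Rightarrow> 'm \<Rightarrow> ('m, 'n) tensor \<Rightarrow> ('m, 'n) tensor"
  assumes "C1_manifold X \<A>"
    and "flat_linear_transport X \<A> L"
    and "C1_transport X \<A> L"
  shows "(\<forall>V S p q. tensor_field X \<A> 1 0 V \<longrightarrow> C1_tensor_field X \<A> p q S \<longrightarrow>
            (\<forall>x\<in>topspace X. \<forall>c\<in>charts_at \<A> x.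
               has_transport_derivative L c V S x (nabla \<A> L V S x))) \<and>
         linear_connection X \<A> (nabla \<A> L)"
proof -
  interpret C1_flat_transport X \<A> L
    using assms by unfold_locales
  show ?thesis
  proof (intro conjI allI impI ballI)
    fix V S p q x c
    assume "tensor_field X \<A> 1 0 V" "C1_tensor_field X \<A> p q S" "x \<in> topspace X" "c \<in> charts_at \<A> x"
    then show "has_transport_derivative L c V S x (nabla \<A> L V S x)"
      by (intro has_transport_derivative_nabla)
  qed (rule linear_connection_nabla)
qed

end
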